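(* Let $q_1,q_2$ be generic and let $\lambda\in\mathbb{C}$ be nonzero. Assume that a subset $Y$ of $n$ vertices of the grid is chosen and that $(0,0)$ belongs to $Y$. Let $X$ be the set of vertices $(a,b)\in Y$ whose neighbors $(a-1,b)$ and $(a,b-1)$ are both also included in $Y$, and let $k$ be the number of elements of $X$. Then the number of rooted binary trees supported on the vertices from $Y$ is either zero or $2^k$. The multiplicity of the point associated to $Y$ is also $2^k$.
   Context: Let $q_1,q_2$ be two complex parameters; generic means $q_1^aq_2^b\neq 1$ for any $a,b\in\mathbb{N}$. The shuffle algebra $S_{q_1,q_2}=\bigoplus_{n\ge0}S_n$ is the associative graded unital algebra over the field $\mathbb{C}(q_1,q_2)$ whose component $S_n$ consists of the rational functions $F(z_1,\dots,z_n)=\frac{f(z_1,\dots,z_n)}{\Delta_n}$ with $f$ a symmetric Laurent polynomial and $\Delta_n=\prod_{i<j}(z_i-z_j)$. For $F\in S_n$, $G\in S_m$ the product is $$F*G=\mathrm{Alt}_{\mathfrak{S}_{n+m}}\Big(F(z_1,\dots,z_n)\,G(z_{n+1},\dots,z_{n+m})\prod_{\substack{1\le i\le n\\ n+1\le j\le n+m}}\mu(z_i,z_j)\Big),$$ where $\mu(x,y)=\frac{(x-q_1y)(x-q_2y)}{(x-y)^2}$, $\mathfrak{S}_k$ is the symmetric group, and $\mathrm{Alt}_{\mathfrak{S}_k}(H)=\frac{1}{k!}\sum_{\sigma\in\mathfrak{S}_k}\mathrm{sgn}(\sigma)H(z_{\sigma(1)},\dots,z_{\sigma(k)})$. $I$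 is the right ideal of $S_{q_1,q_2}$ generated by $(z-\lambda)$, and $I_n$ is its $n$th graded component. Grid: the vertices are the points $(a,b)$ with $a,b$ non-negative integers; the root is $(0,0)$, and $(a,b)$ is reached from the root by $a$ steps down to the left and $b$ steps down to the right. The point associated to a subset of $n$ vertices is the point of $(\mathbb{C}^* )^n/\mathfrak{S}_n$ whose coordinates are the numbers $\lambda q_1^aq_2^b$, one for each vertex $(a,b)$ of the subset. A rooted binary tree supported on a subset has the vertices of the subset as its vertices and $(0,0)$ as its root, and each non-root vertex $(a,b)$ is connected to a parent in the subset that is one of $(a-1,b)$, $(a,b-1)$. The multiplicity of a point is its multiplicity as a common zero of all elements of $I_n$, counted as the rank of the system of linear relations, between the values and the partial derivatives of all orders at the point, that hold for all elements of $I_n$.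
   Formalization: Generic is taken as q1, q2 nonzero and q1^a q2^b ≠ 1 for all integers (a,b) ≠ (0,0); I is generated by all Laurent polynomial multiples of z−λ in degree 1; the multiplicity is 2^k if a tree is supported on Y and 0 otherwise. *)

theory Defs
  imports
    "HOL-Analysis.Analysis"
    "HOL-Combinatorics.Permutations"
    "HOL-Library.Function_Algebras"
    "HOL-Library.Extended_Nat"
begin

section \<open>The shuffle algebra\<close>

text \<open>
  A tuple \<open>(z\<^sub>1, \<dots>, z\<^sub>n)\<close> is a function \<open>z :: nat \<Rightarrow> complex\<close> of which only the values \<open>z i\<close> with
  \<open>i < n\<close> matter (so indices start at 0). A rational function whose poles lie on the coordinate
  hyperplanes and on the diagonals is identified with its values on the set \<open>config n\<close> of tuples
  of pairwise distinct nonzero numbers; it is given the value 0 elsewhere, which makes this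
  representation unique. The parameters \<open>q1\<close> and \<open>q2\<close> are complex numbers, so the field
  generated by them over the complex numbers is just \<open>complex\<close>.
\<close>

type_synonym cfunc = "(nat \<Rightarrow> complex) \<Rightarrow> complex"

definition config :: "nat \<Rightarrow> (nat \<Rightarrow> complex) set" where
  "config n = {z. (\<forall>i<n. z i \<noteq> 0) \<and> inj_on z {..<n}}"

definition laurent :: "nat \<Rightarrow> cfunc set" where
  "laurent n = {f. \<exists>(E :: (nat \<Rightarrow> int) set) c. finite E \<and>
     f = (\<lambda>z. \<Sum>e\<in>E. c e * (\<Prod>i<n. z i powi e i))}"

definition symmetric_fun :: "nat \<Rightarrow> cfunc \<Rightarrow> bool" where
  "symmetric_fun n f \<longleftrightarrow> (\<forall>\<sigma> z. \<sigma> permutes {..<n} \<longrightarrow> f (z \<circ> \<sigma>) = f z)"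

definition Delta :: "nat \<Rightarrow> cfunc" where
  "Delta n z = (\<Prod>j<n. \<Prod>i<j. z i - z j)"

definition shuffle_component :: "nat \<Rightarrow> cfunc set" where
  "shuffle_component n =
     {(\<lambda>z. if z \<in> config n then f z / Delta n z else 0) | f. f \<in> laurent n \<and> symmetric_fun n f}"

definition mu :: "complex \<Rightarrow> complex \<Rightarrow> complex \<Rightarrow> complex \<Rightarrow> complex" where
  "mu q1 q2 x y = (x - q1 * y) * (x - q2 * y) / (x - y)\<^sup>2"

definition Alt :: "nat \<Rightarrow> cfunc \<Rightarrow> cfunc" where
  "Alt k H z = 1 / fact k * (\<Sum>\<sigma> | \<sigma> permutes {..<k}. of_int (sign \<sigma>) * H (z \<circ> \<sigma>))"

text \<open>
  The product of components of degrees \<open>n\<close> and \<open>m\<close>. Outside \<open>config (n + m)\<close> every summand is 0,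
  because one of its factors is (recall \<open>x / 0 = 0\<close> for the factors \<open>mu\<close>).
\<close>

definition shuffle_prod ::
    "complex \<Rightarrow> complex \<Rightarrow> nat \<Rightarrow> nat \<Rightarrow> cfunc \<Rightarrow> cfunc \<Rightarrow> cfunc" where
  "shuffle_prod q1 q2 n m F G =
     Alt (n + m) (\<lambda>z. F z * G (\<lambda>i. z (n + i)) * (\<Prod>i<n. \<Prod>j\<in>{n..<n + m}. mu q1 q2 (z i) (z j)))"

text \<open>Elements of the direct sum are finitely supported sequences of homogeneous components.\<close>

definition shuffle_algebra :: "(nat \<Rightarrow> cfunc) set" where
  "shuffle_algebra = {F. (\<forall>n. F n \<in> shuffle_component n) \<and> finite {n. F n \<noteq> 0}}"

definition shuffle_mult ::
    "complex \<Rightarrow> complex \<Rightarrow> (nat \<Rightarrow> cfunc) \<Rightarrow> (nat \<Rightarrow> cfunc) \<Rightarrow> (nat \<Rightarrow> cfunc)" where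
  "shuffle_mult q1 q2 F G n = (\<Sum>k\<le>n. shuffle_prod q1 q2 k (n - k) (F k) (G (n - k)))"

definition homogeneous :: "nat \<Rightarrow> cfunc \<Rightarrow> (nat \<Rightarrow> cfunc)" where
  "homogeneous n F = (\<lambda>m. if m = n then F else 0)"

text \<open>
  Closure under scalars (and negation) comes from right multiplication by elements of degree 0.
\<close>

inductive_set right_ideal_generated ::
    "complex \<Rightarrow> complex \<Rightarrow> (nat \<Rightarrow> cfunc) set \<Rightarrow> (nat \<Rightarrow> cfunc) set"
  for q1 q2 :: complex and A :: "(nat \<Rightarrow> cfunc) set" where
  generator: "F \<in> A \<Longrightarrow> F \<in> right_ideal_generated q1 q2 A"
| zero: "0 \<in> right_ideal_generated q1 q2 A"
| add: "F \<in> right_ideal_generated q1 q2 A \<Longrightarrow> G \<in> right_ideal_generated q1 q2 A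
    \<Longrightarrow> F + G \<in> right_ideal_generated q1 q2 A"
| mult: "F \<in> right_ideal_generated q1 q2 A \<Longrightarrow> G \<in> shuffle_algebra
    \<Longrightarrow> shuffle_mult q1 q2 F G \<in> right_ideal_generated q1 q2 A"

text \<open>
  The generators are the ideal \<open>(z - \<lambda>)\<close> of the ring of Laurent polynomials in one variable, that
  is, of the degree 1 component with the ordinary product of functions. (The right ideal generated
  by the single function \<open>z - \<lambda>\<close> has a one-dimensional degree 1 component; its elements satisfy
  infinitely many independent linear relations at every point.)
\<close>

definition ideal_generators :: "complex \<Rightarrow> (nat \<Rightarrow> cfunc) set" where
  "ideal_generators l = {homogeneous 1 (\<lambda>z. (z 0 - l) * G z) | G. G \<in> shuffle_component 1}"

definition ideal_I :: "complex \<Rightarrow> complex \<Rightarrow> complex \<Rightarrow> (nat \<Rightarrow> cfunc) set" where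
  "ideal_I q1 q2 l = right_ideal_generated q1 q2 (ideal_generators l)"

definition ideal_component :: "complex \<Rightarrow> complex \<Rightarrow> complex \<Rightarrow> nat \<Rightarrow> cfunc set" where
  "ideal_component q1 q2 l n = (\<lambda>F. F n) ` ideal_I q1 q2 l"

section \<open>Multiplicity of a common zero\<close>

definition partial_deriv :: "nat \<Rightarrow> cfunc \<Rightarrow> cfunc" where
  "partial_deriv i F z = deriv (\<lambda>t. F (z(i := t))) (z i)"

definition multi_deriv :: "nat \<Rightarrow> (nat \<Rightarrow> nat) \<Rightarrow> cfunc \<Rightarrow> cfunc" where
  "multi_deriv n \<alpha> F = fold (\<lambda>i. partial_deriv i ^^ \<alpha> i) [0..<n] F"

text \<open>
  A linear relation between the value and the partial derivatives at a point is given by its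
  finitely many nonzero coefficients \<open>c \<alpha>\<close>, indexed by multi-indices \<open>\<alpha>\<close> in \<open>n\<close> variables.
\<close>

definition linear_relations :: "nat \<Rightarrow> cfunc set \<Rightarrow> (nat \<Rightarrow> complex) \<Rightarrow> ((nat \<Rightarrow> nat) \<Rightarrow> complex) set"
  where
  "linear_relations n V p = {c. finite {\<alpha>. c \<alpha> \<noteq> 0} \<and> (\<forall>\<alpha>. c \<alpha> \<noteq> 0 \<longrightarrow> (\<forall>i\<ge>n. \<alpha> i = 0)) \<and>
     (\<forall>F\<in>V. (\<Sum>\<alpha> | c \<alpha> \<noteq> 0. c \<alpha> * multi_deriv n \<alpha> F p) = 0)}"

definition cscale :: "complex \<Rightarrow> ('a \<Rightarrow> complex) \<Rightarrow> ('a \<Rightarrow> complex)" where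
  "cscale a f = (\<lambda>x. a * f x)"

interpretation cfun: vector_space cscale
  by unfold_locales (auto simp: cscale_def fun_eq_iff algebra_simps)

text \<open>The rank is an extended natural number, so that infinite rank is not confused with 0.\<close>

definition zero_multiplicity :: "nat \<Rightarrow> cfunc set \<Rightarrow> (nat \<Rightarrow> complex) \<Rightarrow> enat" where
  "zero_multiplicity n V p =
     (SUP B \<in> {B. B \<subseteq> linear_relations n V p \<and> finite B \<and> cfun.independent B}. enat (card B))"

section \<open>The grid\<close>

text \<open>
  The exponents range over the integers: with natural exponents only, \<open>q1 = q2\<close> would be
  allowed, and different vertices of the grid could give the same coordinate.
\<close>

definition generic :: "complex \<Rightarrow> complex \<Rightarrow> bool" where
  "generic q1 q2 \<longleftrightarrow> q1 \<noteq> 0 \<and> q2 \<noteq> 0 \<and>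
     (\<forall>a b :: int. (a, b) \<noteq> (0, 0) \<longrightarrow> q1 powi a * q2 powi b \<noteq> 1)"

definition vertex_coord :: "complex \<Rightarrow> complex \<Rightarrow> complex \<Rightarrow> nat \<times> nat \<Rightarrow> complex" where
  "vertex_coord q1 q2 l v = l * q1 ^ fst v * q2 ^ snd v"

definition grid_parent :: "nat \<times> nat \<Rightarrow> nat \<times> nat \<Rightarrow> bool" where
  "grid_parent v w \<longleftrightarrow>
     (fst v = Suc (fst w) \<and> snd v = snd w) \<or> (fst v = fst w \<and> snd v = Suc (snd w))"

text \<open>
  A tree is given by its set of edges, directed from child to parent. Parents are one level
  closer to the root, so such a set of edges never contains a cycle and connects every vertex to
  \<open>(0, 0)\<close>.
\<close>

definition trees_on :: "(nat \<times> nat) set \<Rightarrow> ((nat \<times> nat) \<times> (nat \<times> nat)) set set" where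
  "trees_on Y = {T. (0, 0) \<in> Y \<and> (\<forall>(v, w)\<in>T. v \<in> Y \<and> w \<in> Y \<and> grid_parent v w) \<and>
     (\<forall>v\<in>Y - {(0, 0)}. \<exists>!w. (v, w) \<in> T)}"

definition double_parent_vertices :: "(nat \<times> nat) set \<Rightarrow> (nat \<times> nat) set" where
  "double_parent_vertices Y =
     {(a, b). (a, b) \<in> Y \<and> a > 0 \<and> b > 0 \<and> (a - 1, b) \<in> Y \<and> (a, b - 1) \<in> Y}"

end

theory Submission
  imports Defs
begin

text \<open>
  A point of \<open>config n\<close> has distinct nonzero coordinates, so all denominators are invertible there,
  and a product of a univariate Laurent polynomial vanishing at \<open>\<lambda>\<close> with an element of degree
  \<open>n - 1\<close> is a combination of the functions
  \<open>P\<^sub>i = (z\<^sub>i - \<lambda>) \<Prod>\<^bsub>j \<noteq> i\<^esub> (z\<^sub>i - q\<^sub>1 z\<^sub>j) (z\<^sub>i - q\<^sub>2 z\<^sub>j)\<close>. Conversely, interpolation at the coordinates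
  of the point yields, to any order, each single \<open>P\<^sub>i\<close> times an arbitrary jet. Hence the linear
  relations are the functionals on jets that kill the ideal generated by the \<open>P\<^sub>i\<close>. Up to units,
  \<open>P\<^sub>i\<close> is the product of its factors vanishing at the point; in the coordinates \<open>y\<^sub>i\<close> centered at the
  point these are \<open>y\<^sub>i\<close> for the root and \<open>y\<^sub>i - q y\<^sub>j\<close> for each parent \<open>j\<close> of \<open>i\<close>. If a
  vertex other than the root has no parent, the ideal contains a unit. Otherwise the quotient is an
  iterated extension, level by level, of degree 2 at each vertex with two parents and of degree 1
  elsewhere, so it has dimension \<open>2\<^sup>k\<close>. In terms of the values of a functional at the monomials, its
  dual is the solution space of a linear recurrence.
\<close>

section \<open>Regular functions and their order of vanishing\<close>

text \<open>In an element of the ideal all \<open>P_i\<close> occur together, in one alternating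
  sum. They can be isolated because the coordinates of the point are distinct: a univariate
  polynomial in the degree 1 factor can be congruent to 1 at one coordinate and to 0 at all others,
  so that only the permutations putting that coordinate first survive. This works only to a finite
  order. Every interpolation and every division by a unit is therefore done modulo a power of the
  ideal of the point; a relation has finitely many coefficients and does not see the difference. The
  number 2^k comes from homogeneity. The recurrences keep the total degree and move it to lower
  levels, so a functional is determined by its values at the squarefree monomials in the variables
  with two parents, and these values can be prescribed freely. Homogeneity also bounds the degree,
  so every solution has finite support and is an actual relation. The number of trees is the product
  of the numbers of parents of the non-root vertices; a factor 0 there is the same missing parent
  that leaves no nonzero relation.\<close>

lemma config_comp:
  assumes "z \<in> config n" "inj_on \<rho> {..<k}" "\<rho> ` {..<k} \<subseteq> {..<n}"
  shows "z \<circ> \<rho> \<in> config k"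
  using assms by (auto simp: config_def intro!: comp_inj_on intro: inj_on_subset)

lemma config_nonzero: "z \<in> config n \<Longrightarrow> i < n \<Longrightarrow> z i \<noteq> 0"
  by (auto simp: config_def)

lemma config_distinct: "z \<in> config n \<Longrightarrow> i < n \<Longrightarrow> j < n \<Longrightarrow> i \<noteq> j \<Longrightarrow> z i \<noteq> z j"
  by (auto simp: config_def inj_on_def)

text \<open>A value \<open>t\<close> near \<open>z i\<close> only has to avoid 0 and the finitely
  many other coordinates. Hence partial derivatives at points of \<open>config n\<close> depend only
  on values inside \<open>config n\<close>.\<close>

lemma eventually_config_upd:
  assumes "z \<in> config n" "i < n"
  shows "\<forall>\<^sub>F t in nhds (z i). z(i := t) \<in> config n"
proof -
  let ?S = "insert 0 (z ` ({..<n} - {i}))"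
  have "open (- ?S)" by (intro open_Compl finite_imp_closed) auto
  moreover have "z i \<in> - ?S"
    using assms by (auto simp: config_def inj_on_def)
  moreover have "z(i := t) \<in> config n" if "t \<in> - ?S" for t
    using that assms by (auto simp: config_def inj_on_def)
  ultimately show ?thesis by (auto simp: eventually_nhds)
qed

text \<open>
  Functions are compared on \<open>config n\<close> only: the elements of the shuffle algebra are cut off
  outside of it.
\<close>

inductive_set regular :: "nat \<Rightarrow> cfunc set" for n where
  const: "(\<lambda>z. c) \<in> regular n"
| coord: "i < n \<Longrightarrow> (\<lambda>z. z i) \<in> regular n"
| add: "F \<in> regular n \<Longrightarrow> G \<in> regular n \<Longrightarrow> (\<lambda>z. F z + G z) \<in> regular n"
| mult: "F \<in> regular n \<Longrightarrow> G \<in> regular n \<Longrightarrow> (\<lambda>z. F z * G z) \<in> regular n"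
| inverse: "F \<in> regular n \<Longrightarrow> (\<And>z. z \<in> config n \<Longrightarrow> F z \<noteq> 0) \<Longrightarrow> (\<lambda>z. inverse (F z)) \<in> regular n"
| cong: "F \<in> regular n \<Longrightarrow> (\<And>z. z \<in> config n \<Longrightarrow> F z = G z) \<Longrightarrow> G \<in> regular n"

lemma regular_uminus: "F \<in> regular n \<Longrightarrow> (\<lambda>z. - F z) \<in> regular n"
  using regular.mult[OF regular.const[of "-1" n], of F] by simp

lemma regular_diff: "F \<in> regular n \<Longrightarrow> G \<in> regular n \<Longrightarrow> (\<lambda>z. F z - G z) \<in> regular n"
  using regular.add[OF _ regular_uminus, of F n G] by simp

lemma regular_sum: "(\<And>x. x \<in> A \<Longrightarrow> F x \<in> regular n) \<Longrightarrow> (\<lambda>z. \<Sum>x\<in>A. F x z) \<in> regular n"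
  by (induction A rule: infinite_finite_induct) (auto intro: regular.const regular.add)

lemma regular_prod: "(\<And>x. x \<in> A \<Longrightarrow> F x \<in> regular n) \<Longrightarrow> (\<lambda>z. \<Prod>x\<in>A. F x z) \<in> regular n"
  by (induction A rule: infinite_finite_induct) (auto intro: regular.const regular.mult)

lemma regular_power: "F \<in> regular n \<Longrightarrow> (\<lambda>z. F z ^ k) \<in> regular n"
  by (induction k) (auto intro: regular.const regular.mult)

text \<open>Covers permutations of the variables as well as the view of a function of
  \<open>k\<close> variables as one of more variables, possibly shifted. Injectivity of
  \<open>\<rho>\<close> keeps the tuple in \<open>config k\<close>.\<close>

lemma regular_comp:
  assumes "F \<in> regular k" and \<rho>: "inj_on \<rho> {..<k}" "\<rho> ` {..<k} \<subseteq> {..<n}"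
  shows "(\<lambda>z. F (z \<circ> \<rho>)) \<in> regular n"
  using assms(1)
proof induction
  case (coord i)
  then show ?case using \<rho> by (auto intro!: regular.coord)
next
  case (inverse F)
  show ?case
    by (rule regular.inverse[OF inverse.IH]) (use config_comp[OF _ \<rho>] inverse.hyps in blast)
next
  case (cong F G)
  show ?case
    by (rule regular.cong[OF cong.IH]) (use config_comp[OF _ \<rho>] cong.hyps in blast)
qed (auto intro: regular.const regular.add regular.mult)

lemma partial_deriv_eq:
  assumes "(\<lambda>t. F (z(i := t))) field_differentiable at (z i)"
    "\<forall>\<^sub>F t in nhds (z i). F (z(i := t)) = G (z(i := t))"
  shows "(\<lambda>t. G (z(i := t))) field_differentiable at (z i)" "partial_deriv i G z = partial_deriv i F z"
proof -
  have "((\<lambda>t. F (z(i := t))) has_field_derivative partial_deriv i F z) (at (z i))"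
    unfolding partial_deriv_def using assms(1) by (simp add: field_differentiable_derivI)
  then have "((\<lambda>t. G (z(i := t))) has_field_derivative partial_deriv i F z) (at (z i))"
    using DERIV_cong_ev[OF refl assms(2) refl] by simp
  then show "(\<lambda>t. G (z(i := t))) field_differentiable at (z i)" "partial_deriv i G z = partial_deriv i F z"
    by (auto simp: partial_deriv_def field_differentiable_def intro: DERIV_imp_deriv)
qed

lemma partial_deriv_add:
  assumes "(\<lambda>t. F (z(i := t))) field_differentiable at (z i)"
    "(\<lambda>t. G (z(i := t))) field_differentiable at (z i)"
  shows "partial_deriv i (\<lambda>z. F z + G z) z = partial_deriv i F z + partial_deriv i G z"
  using assms by (simp add: partial_deriv_def deriv_add)

lemma partial_deriv_mult:
  assumes "(\<lambda>t. F (z(i := t))) field_differentiable at (z i)"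
    "(\<lambda>t. G (z(i := t))) field_differentiable at (z i)"
  shows "partial_deriv i (\<lambda>z. F z * G z) z = F z * partial_deriv i G z + partial_deriv i F z * G z"
  using assms by (simp add: partial_deriv_def deriv_mult)

text \<open>Both claims go through one induction, since the product and quotient rules need
  differentiability before they give the derivative.\<close>

lemma regular_partial_deriv_aux:
  assumes "F \<in> regular n" "i < n"
  shows "(\<forall>z\<in>config n. (\<lambda>t. F (z(i := t))) field_differentiable at (z i)) \<and>
    partial_deriv i F \<in> regular n"
  using assms(1)
proof induction
  case (const c)
  then show ?case by (simp add: partial_deriv_def[abs_def] regular.const)
next
  case (coord j)
  show ?case
    by (cases "i = j") (auto simp: partial_deriv_def[abs_def] intro: regular.const)
next
  case (add F G)
  then show ?case
    by (auto simp: partial_deriv_add simp del: fun_upd_apply intro!: field_differentiable_add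
        regular.cong[OF regular.add[of "partial_deriv i F" _ "partial_deriv i G"]])
next
  case (mult F G)
  then show ?case
    by (auto simp: partial_deriv_mult simp del: fun_upd_apply intro!: field_differentiable_mult
        regular.cong[OF regular.add[OF regular.mult[of F n "partial_deriv i G"]
            regular.mult[of "partial_deriv i F" n "G"]]])
next
  case (inverse F)
  have d: "partial_deriv i (\<lambda>z. inverse (F z)) z = - (partial_deriv i F z * (inverse (F z) * inverse (F z)))"
    if "z \<in> config n" for z
  proof -
    have "((\<lambda>t. F (z(i := t))) has_field_derivative partial_deriv i F z) (at (z i))"
      unfolding partial_deriv_def by (rule field_differentiable_derivI) (use inverse.IH that in blast)
    from DERIV_inverse'[OF this] show ?thesis
      unfolding partial_deriv_def using inverse(2)[OF that] by (auto intro!: DERIV_imp_deriv simp: mult_ac)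
  qed
  show ?case
    using inverse d
    by (auto simp del: fun_upd_apply intro!: field_differentiable_inverse regular.cong[OF regular_uminus[OF
          regular.mult[OF _ regular.mult[OF regular.inverse regular.inverse], of "partial_deriv i F" n F F]]])
next
  case (cong F G)
  have ev: "\<forall>\<^sub>F t in nhds (z i). F (z(i := t)) = G (z(i := t))" if "z \<in> config n" for z
    using eventually_config_upd[OF that assms(2)] by eventually_elim (use cong in auto)
  show ?case
    using cong partial_deriv_eq[OF _ ev]
    by (auto intro!: regular.cong[of "partial_deriv i F"])
qed

lemma regular_differentiable:
  "F \<in> regular n \<Longrightarrow> i < n \<Longrightarrow> z \<in> config n \<Longrightarrow> (\<lambda>t. F (z(i := t))) field_differentiable at (z i)"
  using regular_partial_deriv_aux by blast

lemma regular_partial_deriv: "F \<in> regular n \<Longrightarrow> i < n \<Longrightarrow> partial_deriv i F \<in> regular n"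
  using regular_partial_deriv_aux by blast

lemma partial_deriv_cong:
  assumes "F \<in> regular n" "i < n" "z \<in> config n" "\<And>z. z \<in> config n \<Longrightarrow> F z = G z"
  shows "partial_deriv i F z = partial_deriv i G z"
proof -
  have "\<forall>\<^sub>F t in nhds (z i). F (z(i := t)) = G (z(i := t))"
    using eventually_config_upd[OF assms(3,2)] by eventually_elim (use assms in auto)
  from partial_deriv_eq(2)[OF regular_differentiable[OF assms(1-3)] this] show ?thesis by simp
qed

text \<open>Membership in the \<open>N\<close>-th power of the ideal generated by the
  \<open>z i - p i\<close> in the ring of regular functions. The description by generators replaces
  Taylor expansions by inductions.\<close>

inductive vanishing :: "nat \<Rightarrow> (nat \<Rightarrow> complex) \<Rightarrow> nat \<Rightarrow> cfunc \<Rightarrow> bool" for n p where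
  regular: "F \<in> regular n \<Longrightarrow> vanishing n p 0 F"
| step: "vanishing n p N F \<Longrightarrow> i < n \<Longrightarrow> vanishing n p (Suc N) (\<lambda>z. (z i - p i) * F z)"
| zero: "vanishing n p N (\<lambda>z. 0)"
| add: "vanishing n p N F \<Longrightarrow> vanishing n p N G \<Longrightarrow> vanishing n p N (\<lambda>z. F z + G z)"
| cong: "vanishing n p N F \<Longrightarrow> (\<And>z. z \<in> config n \<Longrightarrow> F z = G z) \<Longrightarrow> vanishing n p N G"

lemma vanishing_regular: "vanishing n p N F \<Longrightarrow> F \<in> regular n"
proof (induction rule: vanishing.induct)
  case (step N F i)
  then show ?case
    by (intro regular.mult[OF regular_diff[OF regular.coord regular.const]])
next
  case (cong N F G)
  then show ?case by (blast intro: regular.cong)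
qed (auto intro: regular.add regular.const)

lemma vanishing_mult_regular:
  "vanishing n p N F \<Longrightarrow> G \<in> regular n \<Longrightarrow> vanishing n p N (\<lambda>z. F z * G z)"
proof (induction rule: vanishing.induct)
  case (regular F)
  then show ?case by (auto intro: vanishing.regular regular.mult)
next
  case (step N F i)
  from vanishing.step[OF step.IH[OF step.prems] step.hyps(2)] show ?case by (simp add: mult.assoc)
next
  case (zero N)
  then show ?case by (simp add: vanishing.zero)
next
  case (add N F H)
  from vanishing.add[OF add.IH] add.prems show ?case by (simp add: algebra_simps)
next
  case (cong N F H)
  from vanishing.cong[OF cong.IH[OF cong.prems]] cong.hyps show ?case by simp
qed


lemma vanishing_mult:
  "vanishing n p M F \<Longrightarrow> vanishing n p N G \<Longrightarrow> vanishing n p (M + N) (\<lambda>z. F z * G z)"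
proof (induction rule: vanishing.induct)
  case (regular F)
  then show ?case using vanishing_mult_regular[of n p N G F] by (simp add: mult.commute)
next
  case (step M F i)
  from vanishing.step[OF step.IH[OF step.prems] step.hyps(2)] show ?case by (simp add: mult.assoc)
next
  case (zero M)
  then show ?case by (simp add: vanishing.zero)
next
  case (add M F H)
  from vanishing.add[OF add.IH] add.prems show ?case by (simp add: algebra_simps)
next
  case (cong M F H)
  from vanishing.cong[OF cong.IH[OF cong.prems]] cong.hyps show ?case by simp
qed

lemma vanishing_power: "vanishing n p 1 F \<Longrightarrow> vanishing n p N (\<lambda>z. F z ^ N)"
proof (induction N)
  case 0
  then show ?case by (simp add: vanishing.regular regular.const)
next
  case (Suc N)
  from vanishing_mult[OF Suc.prems Suc.IH[OF Suc.prems]] show ?case by simp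
qed

lemma vanishing_sum: "(\<And>x. x \<in> A \<Longrightarrow> vanishing n p N (F x)) \<Longrightarrow> vanishing n p N (\<lambda>z. \<Sum>x\<in>A. F x z)"
  by (induction A rule: infinite_finite_induct) (auto intro: vanishing.zero vanishing.add)

lemma vanishing_uminus: "vanishing n p N F \<Longrightarrow> vanishing n p N (\<lambda>z. - F z)"
  using vanishing_mult_regular[OF _ regular.const[of "-1" n], of p N F] by simp

lemma vanishing_coord: "i < n \<Longrightarrow> vanishing n p 1 (\<lambda>z. z i - p i)"
  using vanishing.step[OF vanishing.regular[OF regular.const[of 1 n]], of i p] by simp

lemma vanishing_Suc_D: "vanishing n p (Suc N) F \<Longrightarrow> vanishing n p N F"
proof (induction "Suc N" F arbitrary: N rule: vanishing.induct)
  case (step N F i)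
  show ?case
  \<comment> \<open>For \<open>N = 0\<close> there is no induction hypothesis for \<open>F\<close>,
    but order 0 only asks for regularity.\<close>
  proof (cases N)
    case 0
    then show ?thesis
      using vanishing_regular[OF step.hyps(1)] step.hyps(3)
      by (auto intro!: vanishing.regular regular.mult regular_diff regular.coord regular.const)
  next
    case (Suc M)
    then show ?thesis using vanishing.step[OF step.hyps(2) step.hyps(3)] by simp
  qed
qed (auto intro: vanishing.zero vanishing.add vanishing.cong)

lemma vanishing_at: "vanishing n p (Suc N) F \<Longrightarrow> p \<in> config n \<Longrightarrow> F p = 0"
  by (induction "Suc N" F arbitrary: N rule: vanishing.induct) auto

text \<open>By the product rule a derivative removes at most one of the factors
  \<open>z j - p j\<close>.\<close>

lemma vanishing_partial_deriv:
  "vanishing n p (Suc N) F \<Longrightarrow> i < n \<Longrightarrow> vanishing n p N (partial_deriv i F)"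
proof (induction "Suc N" F arbitrary: N rule: vanishing.induct)
  case (step N F j)
  have F: "F \<in> regular n" by (rule vanishing_regular[OF step.hyps(1)])
  have y: "(\<lambda>z. z j - p j) \<in> regular n"
    by (intro regular_diff regular.coord regular.const step)
  have d: "partial_deriv i (\<lambda>z. z j - p j) z = (if i = j then 1 else 0)" for z
    by (cases "i = j") (auto simp: partial_deriv_def)
  have "vanishing n p N (\<lambda>z. (z j - p j) * partial_deriv i F z)"
  proof (cases N)
    case 0
    then show ?thesis
      by (auto intro!: vanishing.regular regular.mult y regular_partial_deriv F step)
  next
    case (Suc M)
    then show ?thesis using vanishing.step[OF step.hyps(2)] step by simp
  qed
  moreover have "vanishing n p N (\<lambda>z. (if i = j then 1 else 0) * F z)"
    using step.hyps(1) by (auto intro: vanishing.zero)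
  ultimately have "vanishing n p N (\<lambda>z. (z j - p j) * partial_deriv i F z + (if i = j then 1 else 0) * F z)"
    by (rule vanishing.add)
  then show ?case
    by (rule vanishing.cong)
      (simp add: partial_deriv_mult regular_differentiable[OF F] regular_differentiable[OF y]
        step.prems d del: fun_upd_apply)
next
  case zero
  then show ?case by (simp add: partial_deriv_def[abs_def] vanishing.zero)
next
  case (add F G)
  have "vanishing n p N (\<lambda>z. partial_deriv i F z + partial_deriv i G z)"
    using add by (intro vanishing.add) auto
  then show ?case
    by (rule vanishing.cong)
      (use add.hyps[THEN vanishing_regular] add.prems in
        \<open>simp add: partial_deriv_add regular_differentiable del: fun_upd_apply\<close>)
next
  case (cong F G)
  have "vanishing n p N (partial_deriv i F)" using cong by blast
  then show ?case
    by (rule vanishing.cong) (metis partial_deriv_cong cong.hyps(1,3) cong.prems vanishing_regular)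
qed

text \<open>Products are generated one variable at a time, so that an induction only has to follow
  an exponent raised by 1. Closure under general products is derived.\<close>

inductive_set polyfun :: "nat \<Rightarrow> cfunc set" for n where
  const: "(\<lambda>z. c) \<in> polyfun n"
| add: "f \<in> polyfun n \<Longrightarrow> g \<in> polyfun n \<Longrightarrow> (\<lambda>z. f z + g z) \<in> polyfun n"
| coord_mult: "f \<in> polyfun n \<Longrightarrow> i < n \<Longrightarrow> (\<lambda>z. z i * f z) \<in> polyfun n"

lemma polyfun_coord: "i < n \<Longrightarrow> (\<lambda>z. z i) \<in> polyfun n"
  using polyfun.coord_mult[OF polyfun.const[of 1 n]] by simp

lemma polyfun_mult:
  assumes "f \<in> polyfun n" "g \<in> polyfun n"
  shows "(\<lambda>z. f z * g z) \<in> polyfun n"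
  using assms(1)
proof induction
  case (const c)
  from assms(2) show ?case
  proof induction
    case (add f g)
    from polyfun.add[OF add.IH] show ?case by (simp add: algebra_simps)
  next
    case (coord_mult f i)
    from polyfun.coord_mult[OF coord_mult.IH coord_mult.hyps(2)] show ?case
      by (simp add: algebra_simps)
  qed (auto intro: polyfun.const)
next
  case (add f h)
  from polyfun.add[OF add.IH] show ?case by (simp add: algebra_simps)
next
  case (coord_mult f i)
  from polyfun.coord_mult[OF coord_mult.IH coord_mult.hyps(2)] show ?case
    by (simp add: algebra_simps)
qed

lemma polyfun_diff: "f \<in> polyfun n \<Longrightarrow> g \<in> polyfun n \<Longrightarrow> (\<lambda>z. f z - g z) \<in> polyfun n"
  using polyfun.add[OF _ polyfun_mult[OF polyfun.const[of "-1" n]], of f g] by simp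

lemma polyfun_sum: "(\<And>x. x \<in> A \<Longrightarrow> f x \<in> polyfun n) \<Longrightarrow> (\<lambda>z. \<Sum>x\<in>A. f x z) \<in> polyfun n"
  by (induction A rule: infinite_finite_induct) (auto intro: polyfun.const polyfun.add)

lemma polyfun_prod: "(\<And>x. x \<in> A \<Longrightarrow> f x \<in> polyfun n) \<Longrightarrow> (\<lambda>z. \<Prod>x\<in>A. f x z) \<in> polyfun n"
  by (induction A rule: infinite_finite_induct) (auto intro: polyfun.const polyfun_mult)

lemma polyfun_power: "f \<in> polyfun n \<Longrightarrow> (\<lambda>z. f z ^ k) \<in> polyfun n"
  by (induction k) (auto intro: polyfun.const polyfun_mult)

lemma polyfun_regular: "f \<in> polyfun n \<Longrightarrow> f \<in> regular n"
  by (induction rule: polyfun.induct) (auto intro: regular.intros(1-4))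

lemma polyfun_vanishing:
  assumes "f \<in> polyfun n"
  shows "vanishing n p 1 (\<lambda>z. f z - f p)"
  using assms
proof induction
  case (add f g)
  from vanishing.add[OF add.IH] show ?case by (simp add: algebra_simps)
next
  case (coord_mult f i)
  have "vanishing n p 1 (\<lambda>z. (z i - p i) * f z)"
    by (intro vanishing_mult_regular vanishing_coord polyfun_regular coord_mult)
  from vanishing.add[OF this vanishing_mult_regular[OF coord_mult.IH regular.const[of "p i"]]]
  show ?case by (simp add: algebra_simps)
qed (auto intro: vanishing.zero)

text \<open>\<open>f\<close> is \<open>f p\<close> times \<open>1 - x\<close> with \<open>x\<close>
  vanishing at \<open>p\<close>, so the geometric series for its inverse may be cut off after
  \<open>N\<close> terms.\<close>

lemma polyfun_inverse_mod:
  assumes "f \<in> polyfun n" "f p \<noteq> 0"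
  shows "\<exists>w\<in>polyfun n. vanishing n p N (\<lambda>z. f z * w z - 1)"
proof
  let ?x = "\<lambda>z. 1 - f z / f p"
  let ?w = "\<lambda>z. (1 / f p) * (\<Sum>k<N. ?x z ^ k)"
  have x: "?x \<in> polyfun n"
    using polyfun_diff[OF polyfun.const[of 1] polyfun_mult[OF polyfun.const[of "1 / f p"] assms(1)]]
    by simp
  then show "?w \<in> polyfun n"
    by (intro polyfun_mult polyfun.const polyfun_sum polyfun_power)
  have eq: "f z * ?w z - 1 = - (?x z ^ N)" for z
  proof -
    have "f z * ?w z = (1 - ?x z) * (\<Sum>k<N. ?x z ^ k)" by simp
    also have "\<dots> = 1 - ?x z ^ N" by (rule one_diff_power_eq[symmetric])
    finally show ?thesis by simp
  qed
  have "vanishing n p 1 ?x"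
    using polyfun_vanishing[OF x, of p] assms(2) by simp
  then show "vanishing n p N (\<lambda>z. f z * ?w z - 1)"
    unfolding eq by (intro vanishing_uminus vanishing_power)
qed

text \<open>Modulo a power of the ideal of \<open>p\<close> only polynomials remain, which reduces
  statements about functionals on regular functions to their values at monomials.\<close>

lemma regular_approx:
  assumes "F \<in> regular n" and p: "p \<in> config n"
  shows "\<exists>f\<in>polyfun n. vanishing n p N (\<lambda>z. F z - f z)"
  using assms(1)
proof induction
  case (const c)
  show ?case by (intro bexI[OF _ polyfun.const[of c]]) (simp add: vanishing.zero)
next
  case (coord i)
  show ?case by (intro bexI[OF _ polyfun_coord[OF coord]]) (simp add: vanishing.zero)
next
  case (add F G)
  then obtain f g where "f \<in> polyfun n" "g \<in> polyfun n"
    "vanishing n p N (\<lambda>z. F z - f z)" "vanishing n p N (\<lambda>z. G z - g z)" by blast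
  then show ?case
    using vanishing.add[of n p N "\<lambda>z. F z - f z" "\<lambda>z. G z - g z"]
    by (intro bexI[of _ "\<lambda>z. f z + g z"]) (auto intro: polyfun.add simp: algebra_simps)
next
  case (mult F G)
  then obtain f g where fg: "f \<in> polyfun n" "g \<in> polyfun n"
    "vanishing n p N (\<lambda>z. F z - f z)" "vanishing n p N (\<lambda>z. G z - g z)" by blast
  from vanishing.add[OF vanishing_mult_regular[OF fg(3) mult.hyps(2)]
      vanishing_mult_regular[OF fg(4) polyfun_regular[OF fg(1)]]]
  have "vanishing n p N (\<lambda>z. F z * G z - f z * g z)" by (simp add: algebra_simps)
  then show ?case by (intro bexI[OF _ polyfun_mult[OF fg(1,2)]])
next
  case (inverse F)
  show ?case
  \<comment> \<open>Order 0 is separate: only a congruence of order at least 1 forces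
    \<open>f p = F p\<close>, which makes \<open>f\<close> invertible at \<open>p\<close>.\<close>
  proof (cases N)
    case 0
    show ?thesis
      using inverse.hyps 0
      by (intro bexI[OF _ polyfun.const[of 0]]) (auto intro!: vanishing.regular regular.inverse)
  next
    case (Suc M)
    obtain f where f: "f \<in> polyfun n" "vanishing n p N (\<lambda>z. F z - f z)"
      using inverse.IH by blast
    have "f p = F p" using vanishing_at[OF f(2)[unfolded Suc] p] by simp
    then have "f p \<noteq> 0" using inverse.hyps(2)[OF p] by simp
    then obtain w where w: "w \<in> polyfun n" "vanishing n p N (\<lambda>z. f z * w z - 1)"
      using polyfun_inverse_mod[OF f(1)] by blast
    have "vanishing n p N (\<lambda>z. - ((F z - f z) * w z + (f z * w z - 1)))"
      by (intro vanishing_uminus vanishing.add vanishing_mult_regular polyfun_regular f w)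
    then have "vanishing n p N (\<lambda>z. - ((F z - f z) * w z + (f z * w z - 1)) * inverse (F z))"
      by (intro vanishing_mult_regular regular.inverse inverse.hyps)
    then have "vanishing n p N (\<lambda>z. inverse (F z) - w z)"
      by (rule vanishing.cong) (use inverse.hyps in \<open>simp add: field_simps\<close>)
    then show ?thesis using w by blast
  qed
next
  case (cong F G)
  then obtain f where "f \<in> polyfun n" "vanishing n p N (\<lambda>z. F z - f z)" by blast
  then show ?case
    using cong.hyps by (intro bexI[of _ f]) (auto elim: vanishing.cong)
qed

section \<open>Functionals on jets\<close>

lemma fold_partial_deriv_cong:
  assumes "F \<in> regular n" "set is \<subseteq> {..<n}" "z \<in> config n" "\<And>z. z \<in> config n \<Longrightarrow> F z = G z"
  shows "fold partial_deriv is F z = fold partial_deriv is G z"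
  using assms
proof (induction "is" arbitrary: F G)
  case (Cons i "is")
  then have "partial_deriv i F z = partial_deriv i G z" if "z \<in> config n" for z
    using partial_deriv_cong[of F n i z G] that by auto
  moreover have "partial_deriv i F \<in> regular n"
    using Cons by (auto intro: regular_partial_deriv)
  ultimately show ?case using Cons by simp
qed simp

lemma fold_partial_deriv_add:
  assumes "F \<in> regular n" "G \<in> regular n" "set is \<subseteq> {..<n}" "z \<in> config n"
  shows "fold partial_deriv is (\<lambda>z. F z + G z) z = fold partial_deriv is F z + fold partial_deriv is G z"
  using assms
proof (induction "is" arbitrary: F G)
  case (Cons i "is")
  have i: "i < n" "set is \<subseteq> {..<n}" using Cons.prems by auto
  have "fold partial_deriv is (partial_deriv i (\<lambda>z. F z + G z)) z =
      fold partial_deriv is (\<lambda>z. partial_deriv i F z + partial_deriv i G z) z"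
    by (rule fold_partial_deriv_cong[of _ n])
      (use Cons.prems i in \<open>auto intro!: regular_partial_deriv regular.add partial_deriv_add
          regular_differentiable simp del: fun_upd_apply\<close>)
  then show ?case
    using Cons.IH[OF regular_partial_deriv regular_partial_deriv] Cons.prems i by simp
qed simp

lemma fold_partial_deriv_scale:
  assumes "F \<in> regular n" "set is \<subseteq> {..<n}" "z \<in> config n"
  shows "fold partial_deriv is (\<lambda>z. c * F z) z = c * fold partial_deriv is F z"
  using assms
proof (induction "is" arbitrary: F)
  case (Cons i "is")
  have i: "i < n" "set is \<subseteq> {..<n}" using Cons.prems by auto
  have "partial_deriv i (\<lambda>z. c * F z) z = c * partial_deriv i F z" if "z \<in> config n" for z
    using regular_differentiable[OF Cons.prems(1) i(1) that] by (simp add: partial_deriv_def del: fun_upd_apply)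
  then have "fold partial_deriv is (partial_deriv i (\<lambda>z. c * F z)) z =
      fold partial_deriv is (\<lambda>z. c * partial_deriv i F z) z"
    by (intro fold_partial_deriv_cong[of _ n])
      (use Cons.prems i in \<open>auto intro!: regular_partial_deriv regular.mult regular.const\<close>)
  then show ?case
    using Cons.IH[OF regular_partial_deriv] Cons.prems i by simp
qed simp

lemma vanishing_fold_partial_deriv:
  "vanishing n p (length is + N) F \<Longrightarrow> set is \<subseteq> {..<n} \<Longrightarrow> vanishing n p N (fold partial_deriv is F)"
  by (induction "is" arbitrary: F) (auto intro: vanishing_partial_deriv)

text \<open>Lists the variables of a multi-index with repetition, so that inductions can take one
  derivative at a time.\<close>

definition deriv_word :: "nat \<Rightarrow> (nat \<Rightarrow> nat) \<Rightarrow> nat list" where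
  "deriv_word n \<alpha> = concat (map (\<lambda>i. replicate (\<alpha> i) i) [0..<n])"

lemma multi_deriv_eq_fold: "multi_deriv n \<alpha> F = fold partial_deriv (deriv_word n \<alpha>) F"
proof -
  have "fold f (replicate k i) = f i ^^ k" for f :: "nat \<Rightarrow> cfunc \<Rightarrow> cfunc" and k i
    by (induction k) (auto simp: funpow_swap1 fun_eq_iff)
  then have "fold (\<lambda>i. f i ^^ \<alpha> i) is F = fold f (concat (map (\<lambda>i. replicate (\<alpha> i) i) is)) F"
    for f :: "nat \<Rightarrow> cfunc \<Rightarrow> cfunc" and "is"
    by (induction "is" arbitrary: F) auto
  then show ?thesis by (simp add: multi_deriv_def deriv_word_def)
qed

lemma set_deriv_word: "set (deriv_word n \<alpha>) \<subseteq> {..<n}"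
  by (auto simp: deriv_word_def)

definition jet_functional :: "nat \<Rightarrow> (nat \<Rightarrow> complex) \<Rightarrow> ((nat \<Rightarrow> nat) \<Rightarrow> complex) \<Rightarrow> cfunc \<Rightarrow> complex"
  where "jet_functional n p c F = (\<Sum>\<alpha> | c \<alpha> \<noteq> 0. c \<alpha> * multi_deriv n \<alpha> F p)"

lemma jet_functional_add:
  "p \<in> config n \<Longrightarrow> F \<in> regular n \<Longrightarrow> G \<in> regular n \<Longrightarrow>
    jet_functional n p c (\<lambda>z. F z + G z) = jet_functional n p c F + jet_functional n p c G"
  by (simp add: jet_functional_def multi_deriv_eq_fold fold_partial_deriv_add[OF _ _ set_deriv_word]
      algebra_simps sum.distrib)

lemma jet_functional_scale:
  "p \<in> config n \<Longrightarrow> F \<in> regular n \<Longrightarrow>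
    jet_functional n p c (\<lambda>z. a * F z) = a * jet_functional n p c F"
  by (simp add: jet_functional_def multi_deriv_eq_fold fold_partial_deriv_scale[OF _ set_deriv_word]
      algebra_simps sum_distrib_left)

lemma jet_functional_diff:
  "p \<in> config n \<Longrightarrow> F \<in> regular n \<Longrightarrow> G \<in> regular n \<Longrightarrow>
    jet_functional n p c (\<lambda>z. F z - G z) = jet_functional n p c F - jet_functional n p c G"
  using jet_functional_add[of p n F "\<lambda>z. -1 * G z" c] jet_functional_scale[of p n G c "-1"]
    regular_uminus[of G n] by simp

lemma jet_functional_zero [simp]: "jet_functional n p c (\<lambda>z. 0) = 0"
proof -
  have "fold partial_deriv is (\<lambda>z. 0) = (\<lambda>z. 0)" for "is"
    by (induction "is") (auto simp: partial_deriv_def[abs_def])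
  then show ?thesis by (simp add: jet_functional_def multi_deriv_eq_fold)
qed

lemma jet_functional_sum:
  "p \<in> config n \<Longrightarrow> (\<And>x. x \<in> A \<Longrightarrow> F x \<in> regular n) \<Longrightarrow>
    jet_functional n p c (\<lambda>z. \<Sum>x\<in>A. F x z) = (\<Sum>x\<in>A. jet_functional n p c (F x))"
  by (induction A rule: infinite_finite_induct) (auto simp: jet_functional_add regular_sum)

lemma jet_functional_cong:
  "p \<in> config n \<Longrightarrow> F \<in> regular n \<Longrightarrow> (\<And>z. z \<in> config n \<Longrightarrow> F z = G z) \<Longrightarrow>
    jet_functional n p c F = jet_functional n p c G"
  by (simp add: jet_functional_def multi_deriv_eq_fold
      fold_partial_deriv_cong[OF _ set_deriv_word, where F = F and G = G])

lemma vanishing_antimono: "vanishing n p (N + k) F \<Longrightarrow> vanishing n p N F"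
  by (induction k) (auto dest: vanishing_Suc_D)

text \<open>Finitely many coefficients involve derivatives of bounded total order, which are blind
  to high powers of the ideal of \<open>p\<close>. Congruences of sufficient order thus become
  equalities under the functional.\<close>

lemma jet_functional_vanishing:
  assumes "finite {\<alpha>. c \<alpha> \<noteq> 0}" "p \<in> config n"
  obtains N where "\<And>F. vanishing n p N F \<Longrightarrow> jet_functional n p c F = 0"
proof -
  obtain M where M: "\<And>\<alpha>. c \<alpha> \<noteq> 0 \<Longrightarrow> length (deriv_word n \<alpha>) \<le> M"
    using assms(1) finite_nat_set_iff_bounded_le[of "(\<lambda>\<alpha>. length (deriv_word n \<alpha>)) ` {\<alpha>. c \<alpha> \<noteq> 0}"]
    by auto
  have "multi_deriv n \<alpha> F p = 0" if F: "vanishing n p (Suc M) F" and "c \<alpha> \<noteq> 0" for F \<alpha>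
  proof -
    have "vanishing n p (length (deriv_word n \<alpha>) + 1) F"
      by (rule vanishing_antimono[where k = "M - length (deriv_word n \<alpha>)"]) (use F M[OF that(2)] in simp)
    then have "vanishing n p 1 (multi_deriv n \<alpha> F)"
      unfolding multi_deriv_eq_fold by (rule vanishing_fold_partial_deriv[OF _ set_deriv_word])
    then show ?thesis using vanishing_at assms(2) by simp
  qed
  then show ?thesis by (intro that[of "Suc M"]) (simp add: jet_functional_def)
qed

section \<open>Values of functionals at monomials in centered coordinates\<close>

definition shifted_monomial :: "nat \<Rightarrow> (nat \<Rightarrow> complex) \<Rightarrow> (nat \<Rightarrow> nat) \<Rightarrow> cfunc" where
  "shifted_monomial n p \<gamma> z = (\<Prod>i<n. (z i - p i) ^ \<gamma> i)"

lemma shifted_monomial_polyfun: "shifted_monomial n p \<gamma> \<in> polyfun n"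
  unfolding shifted_monomial_def[abs_def]
  by (intro polyfun_prod polyfun_power polyfun_diff polyfun_coord polyfun.const) simp

lemma shifted_monomial_Suc:
  assumes "i < n"
  shows "shifted_monomial n p (\<gamma>(i := Suc (\<gamma> i))) z = (z i - p i) * shifted_monomial n p \<gamma> z"
  using assms by (simp add: shifted_monomial_def prod.remove[of "{..<n}" i])

lemma partial_deriv_shifted_monomial:
  assumes "i < n"
  shows "partial_deriv i (\<lambda>z. C * shifted_monomial n p \<gamma> z) =
    (\<lambda>z. C * of_nat (\<gamma> i) * shifted_monomial n p (\<gamma>(i := \<gamma> i - 1)) z)"
proof
  fix z :: "nat \<Rightarrow> complex"
  let ?R = "\<Prod>j\<in>{..<n} - {i}. (z j - p j) ^ \<gamma> j"
  have "((\<lambda>t. C * ((t - p i) ^ \<gamma> i * ?R)) has_field_derivative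
      C * of_nat (\<gamma> i) * ((z i - p i) ^ (\<gamma> i - 1) * ?R)) (at (z i))"
    by (auto intro!: derivative_eq_intros)
  then show "partial_deriv i (\<lambda>z. C * shifted_monomial n p \<gamma> z) z =
      C * of_nat (\<gamma> i) * shifted_monomial n p (\<gamma>(i := \<gamma> i - 1)) z"
    using assms by (simp add: partial_deriv_def shifted_monomial_def prod.remove[of "{..<n}" i] DERIV_imp_deriv)
qed

text \<open>The product is a falling factorial. Subtraction of naturals truncates, but for
  \<open>k > \<gamma> i\<close> the factor with \<open>s = \<gamma> i\<close> is 0, so the formula
  stays correct.\<close>

lemma funpow_partial_deriv_shifted_monomial:
  assumes "i < n"
  shows "(partial_deriv i ^^ k) (\<lambda>z. C * shifted_monomial n p \<gamma> z) =
    (\<lambda>z. C * (\<Prod>s<k. of_nat (\<gamma> i - s)) * shifted_monomial n p (\<gamma>(i := \<gamma> i - k)) z)"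
proof (induction k)
  case (Suc k)
  have "(partial_deriv i ^^ Suc k) (\<lambda>z. C * shifted_monomial n p \<gamma> z) =
    partial_deriv i (\<lambda>z. (C * (\<Prod>s<k. of_nat (\<gamma> i - s))) * shifted_monomial n p (\<gamma>(i := \<gamma> i - k)) z)"
    by (simp only: funpow.simps o_apply Suc)
  also have "\<dots> = (\<lambda>z. C * (\<Prod>s<Suc k. of_nat (\<gamma> i - s)) * shifted_monomial n p (\<gamma>(i := \<gamma> i - Suc k)) z)"
    by (subst partial_deriv_shifted_monomial[OF assms]) (simp add: mult.assoc)
  finally show ?case .
qed simp

lemma multi_deriv_shifted_monomial:
  "multi_deriv n \<alpha> (shifted_monomial n p \<gamma>) =
    (\<lambda>z. (\<Prod>i<n. \<Prod>s<\<alpha> i. of_nat (\<gamma> i - s)) * shifted_monomial n p (\<lambda>i. \<gamma> i - \<alpha> i) z)"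
proof -
  have "fold (\<lambda>i. partial_deriv i ^^ \<alpha> i) [0..<m] (\<lambda>z. 1 * shifted_monomial n p \<gamma> z) =
      (\<lambda>z. (\<Prod>i<m. \<Prod>s<\<alpha> i. of_nat (\<gamma> i - s)) *
        shifted_monomial n p (\<lambda>i. if i < m then \<gamma> i - \<alpha> i else \<gamma> i) z)" if "m \<le> n" for m
    using that
  proof (induction m)
    case (Suc m)
    have upd: "(\<lambda>i. if i < m then \<gamma> i - \<alpha> i else \<gamma> i)(m := \<gamma> m - \<alpha> m) =
        (\<lambda>i. if i < Suc m then \<gamma> i - \<alpha> i else \<gamma> i)" by auto
    show ?case
      using Suc by (simp add: funpow_partial_deriv_shifted_monomial upd)
  qed simp
  from this[of n] show ?thesis
    by (simp add: multi_deriv_def shifted_monomial_def[abs_def])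
qed

lemma multi_deriv_shifted_monomial_at:
  "multi_deriv n \<alpha> (shifted_monomial n p \<gamma>) p =
    (if \<forall>i<n. \<alpha> i = \<gamma> i then \<Prod>i<n. fact (\<gamma> i) else 0)"
proof -
  \<comment> \<open>For \<open>k < m\<close> the power of 0 vanishes, for \<open>k > m\<close> the
    factor with \<open>s = m\<close> does; for \<open>k = m\<close> the power is
    \<open>0 ^ 0 = 1\<close>.\<close>
  have ff: "(\<Prod>s<k. of_nat (m - s)) * 0 ^ (m - k) = (if k = m then fact m else 0 :: complex)" for k m :: nat
  proof (cases k m rule: linorder_cases)
    case less
    then show ?thesis by simp
  next
    case equal
    have "(\<Prod>s<m. of_nat (m - s)) = (fact m :: complex)"
      unfolding fact_prod_rev by (simp add: atLeast0LessThan)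
    then show ?thesis using equal by simp
  next
    case greater
    then show ?thesis by (auto intro!: prod_zero)
  qed
  have "multi_deriv n \<alpha> (shifted_monomial n p \<gamma>) p =
      (\<Prod>i<n. (\<Prod>s<\<alpha> i. of_nat (\<gamma> i - s)) * 0 ^ (\<gamma> i - \<alpha> i))"
    by (simp add: multi_deriv_shifted_monomial shifted_monomial_def prod.distrib)
  also have "\<dots> = (\<Prod>i<n. if \<alpha> i = \<gamma> i then fact (\<gamma> i) else 0)"
    by (simp only: ff)
  also have "\<dots> = (if \<forall>i<n. \<alpha> i = \<gamma> i then \<Prod>i<n. fact (\<gamma> i) else 0)"
    by (auto intro!: prod.cong)
  finally show ?thesis .
qed

text \<open>Monomials and partial derivatives at \<open>p\<close> are dual up to factorials, so the
  coefficients of a relation can be read off from its values at monomials.\<close>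

lemma jet_functional_shifted_monomial:
  assumes "finite {\<alpha>. c \<alpha> \<noteq> 0}" "\<And>\<alpha> i. c \<alpha> \<noteq> 0 \<Longrightarrow> i \<ge> n \<Longrightarrow> \<alpha> i = 0"
  shows "jet_functional n p c (shifted_monomial n p \<gamma>) =
    c (\<lambda>i. if i < n then \<gamma> i else 0) * (\<Prod>i<n. fact (\<gamma> i))"
proof -
  let ?g = "\<lambda>i. if i < n then \<gamma> i else 0"
  have "jet_functional n p c (shifted_monomial n p \<gamma>) =
      (\<Sum>\<alpha> | c \<alpha> \<noteq> 0. if \<alpha> = ?g then c ?g * (\<Prod>i<n. fact (\<gamma> i)) else 0)"
    unfolding jet_functional_def
  proof (rule sum.cong[OF refl])
    fix \<alpha> assume "\<alpha> \<in> {\<alpha>. c \<alpha> \<noteq> 0}"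
    then have "\<alpha> = ?g \<longleftrightarrow> (\<forall>i<n. \<alpha> i = \<gamma> i)"
      using assms(2)[of \<alpha>] by (auto simp: fun_eq_iff)
    then show "c \<alpha> * multi_deriv n \<alpha> (shifted_monomial n p \<gamma>) p =
        (if \<alpha> = ?g then c ?g * (\<Prod>i<n. fact (\<gamma> i)) else 0)"
      by (cases "\<alpha> = ?g") (auto simp: multi_deriv_shifted_monomial_at)
  qed
  also have "\<dots> = c ?g * (\<Prod>i<n. fact (\<gamma> i))"
    using assms(1) by (simp add: sum.delta)
  finally show ?thesis .
qed

lemma jet_functional_polyfun_zeroI:
  assumes p: "p \<in> config n" and "F \<in> regular n" and "f \<in> polyfun n"
    and "\<And>\<gamma>. jet_functional n p c (\<lambda>z. F z * shifted_monomial n p \<gamma> z) = 0"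
  shows "jet_functional n p c (\<lambda>z. F z * f z) = 0"
proof -
  have reg: "(\<lambda>z. F z * g z * shifted_monomial n p \<gamma> z) \<in> regular n" if "g \<in> polyfun n" for g \<gamma>
    by (intro regular.mult assms(2) polyfun_regular that shifted_monomial_polyfun)
  \<comment> \<open>The monomial factor strengthens the claim: multiplication by
    \<open>z i = (z i - p i) + p i\<close> raises an exponent in one term and only rescales the
    other.\<close>
  have "jet_functional n p c (\<lambda>z. F z * f z * shifted_monomial n p \<gamma> z) = 0" for \<gamma>
    using assms(3)
  proof (induction arbitrary: \<gamma>)
    case (const a)
    have "jet_functional n p c (\<lambda>z. a * (F z * 1 * shifted_monomial n p \<gamma> z)) = 0"
      by (subst jet_functional_scale[OF p reg[OF polyfun.const]]) (simp add: assms(4))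
    then show ?case by (simp add: algebra_simps)
  next
    case (add f g)
    have "jet_functional n p c (\<lambda>z. F z * f z * shifted_monomial n p \<gamma> z + F z * g z * shifted_monomial n p \<gamma> z) = 0"
      by (subst jet_functional_add[OF p reg reg]) (auto simp: add)
    then show ?case by (simp add: algebra_simps)
  next
    case (coord_mult f i)
    have "jet_functional n p c (\<lambda>z. F z * f z * shifted_monomial n p (\<gamma>(i := Suc (\<gamma> i))) z +
        p i * (F z * f z * shifted_monomial n p \<gamma> z)) = 0"
      using coord_mult reg[OF coord_mult.hyps(1)]
      by (simp add: jet_functional_add[OF p] jet_functional_scale[OF p] regular.mult[OF regular.const]
          del: fun_upd_apply)
    then show ?case
      by (simp add: shifted_monomial_Suc[OF coord_mult.hyps(2)] algebra_simps)
  qed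
  from this[of "\<lambda>_. 0"] show ?thesis by (simp add: shifted_monomial_def)
qed

section \<open>Solutions of the recurrences\<close>

definition inc :: "nat \<Rightarrow> (nat \<Rightarrow> nat) \<Rightarrow> nat \<Rightarrow> nat" where
  "inc i \<gamma> = \<gamma>(i := Suc (\<gamma> i))"

lemma inc_commute: "inc i (inc j \<gamma>) = inc j (inc i \<gamma>)"
  by (auto simp: inc_def fun_eq_iff)

lemma inc_apply: "inc i \<gamma> j = (if j = i then Suc (\<gamma> i) else \<gamma> j)"
  by (simp add: inc_def)

lemma inc_upd: "i \<noteq> j \<Longrightarrow> (inc i \<gamma>)(j := m) = inc i (\<gamma>(j := m))"
  by (auto simp: inc_def fun_eq_iff)

lemma inc_upd_same: "(inc i \<gamma>)(i := m) = \<gamma>(i := m)"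
  by (auto simp: inc_def fun_eq_iff)

text \<open>The exponent of the squarefree monomial with variable set \<open>T\<close>. Those with
  \<open>T \<subseteq> X\<close> will turn out to be a basis of the quotient, whence the count of
  subsets.\<close>

definition set_index :: "nat set \<Rightarrow> nat \<Rightarrow> nat" where
  "set_index T i = (if i \<in> T then 1 else 0)"

lemma set_index_inj: "set_index S = set_index T \<longleftrightarrow> S = T"
  by (auto simp: set_index_def fun_eq_iff split: if_splits)

text \<open>\<open>a\<close> and \<open>b\<close> stand for the parents, \<open>r\<close> and
  \<open>s\<close> for the ratios of the coordinates, \<open>lev\<close> for the distance from the
  root. The root is included with \<open>r i = 0\<close>: its recurrence says that multiples of its
  variable are killed. Then \<open>a i\<close> is a dummy index, which explains the premise of
  \<open>lev_a\<close>.\<close>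

locale level_recurrence =
  fixes n :: nat and X :: "nat set" and a b :: "nat \<Rightarrow> nat" and r s :: "nat \<Rightarrow> complex"
    and lev :: "nat \<Rightarrow> nat"
  assumes X_less: "X \<subseteq> {..<n}"
    and a_less: "i < n \<Longrightarrow> a i < n"
    and b_less: "i \<in> X \<Longrightarrow> b i < n"
    and lev_a: "i < n \<Longrightarrow> i \<in> X \<or> r i \<noteq> 0 \<Longrightarrow> lev (a i) < lev i"
    and lev_b: "i \<in> X \<Longrightarrow> lev (b i) < lev i"
begin

text \<open>
  Writing \<open>\<phi> \<gamma>\<close> for the value of a linear functional at the monomial \<open>y\<^sup>\<gamma>\<close>, this says that the
  functional kills the multiples of \<open>y\<^sub>i - r\<^sub>i y\<^bsub>a i\<^esub>\<close> or of
  \<open>(y\<^sub>i - r\<^sub>i y\<^bsub>a i\<^esub>) (y\<^sub>i - s\<^sub>i y\<^bsub>b i\<^esub>)\<close>.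
\<close>

definition recurrence :: "nat \<Rightarrow> ((nat \<Rightarrow> nat) \<Rightarrow> complex) \<Rightarrow> bool" where
  "recurrence i \<phi> \<longleftrightarrow> (\<forall>\<gamma>. if i \<in> X
     then \<phi> (inc i (inc i \<gamma>)) = r i * \<phi> (inc i (inc (a i) \<gamma>)) + s i * \<phi> (inc i (inc (b i) \<gamma>))
       - r i * s i * \<phi> (inc (a i) (inc (b i) \<gamma>))
     else \<phi> (inc i \<gamma>) = r i * \<phi> (inc (a i) \<gamma>))"

definition solution :: "((nat \<Rightarrow> nat) \<Rightarrow> complex) \<Rightarrow> bool" where
  "solution \<phi> \<longleftrightarrow> (\<forall>i<n. recurrence i \<phi>)"

lemma recurrence_shift: "recurrence i \<phi> \<Longrightarrow> recurrence i (\<lambda>\<gamma>. \<phi> (inc j \<gamma>))"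
  unfolding recurrence_def by (auto simp: inc_commute[of j])

lemma recurrence_add: "recurrence i \<phi> \<Longrightarrow> recurrence i \<phi>' \<Longrightarrow> recurrence i (\<lambda>\<gamma>. \<phi> \<gamma> + \<phi>' \<gamma>)"
  unfolding recurrence_def by (auto simp: algebra_simps)

lemma recurrence_scale: "recurrence i \<phi> \<Longrightarrow> recurrence i (\<lambda>\<gamma>. c * \<phi> \<gamma>)"
  unfolding recurrence_def by (auto simp: algebra_simps)

text \<open>A recurrence keeps the total degree and replaces a variable by one of lower level, so
  the sum of the \<open>\<gamma> i * lev i\<close> drops. Exponents to which no recurrence applies
  are squarefree and supported in \<open>X\<close>; as the degree is kept, only those of the same
  degree matter.\<close>

lemma solution_unique:
  assumes "solution \<phi>" "\<And>i. i \<ge> n \<Longrightarrow> \<gamma> i = 0"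
    and "\<And>T. T \<subseteq> X \<Longrightarrow> card T = (\<Sum>i<n. \<gamma> i) \<Longrightarrow> \<phi> (set_index T) = 0"
  shows "\<phi> \<gamma> = 0"
  using assms(2-)
proof (induction "\<Sum>i<n. \<gamma> i * lev i" arbitrary: \<gamma> rule: less_induct)
  case less
  have deg: "(\<Sum>i<n. inc j \<delta> i) = Suc (\<Sum>i<n. \<delta> i)" if "j < n" for j \<delta>
    using that by (simp add: sum.remove[of "{..<n}" j] inc_apply)
  have wt: "(\<Sum>i<n. inc j \<delta> i * lev i) = (\<Sum>i<n. \<delta> i * lev i) + lev j" if "j < n" for j \<delta>
    using that by (simp add: sum.remove[of "{..<n}" j] inc_apply)
  have supp: "inc j \<delta> i = 0" if "j < n" "\<delta> i = 0" "i \<ge> n" for i j \<delta>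
    using that by (simp add: inc_apply)
  have IH: "\<phi> \<delta> = 0" if "(\<Sum>i<n. \<delta> i * lev i) < (\<Sum>i<n. \<gamma> i * lev i)" "\<And>i. i \<ge> n \<Longrightarrow> \<delta> i = 0"
    "(\<Sum>i<n. \<delta> i) = (\<Sum>i<n. \<gamma> i)" for \<delta>
    by (rule less.hyps) (use that less.prems in auto)
  consider (single) i where "i < n" "i \<notin> X" "\<gamma> i > 0" | (double) i where "i \<in> X" "\<gamma> i > 1"
    | (reduced) "\<And>i. i < n \<Longrightarrow> \<gamma> i = 0 \<or> i \<in> X \<and> \<gamma> i = 1"
    by (metis Suc_lessI One_nat_def gr0I)
  then show ?case
  proof cases
    case single
    define \<delta> where "\<delta> = \<gamma>(i := \<gamma> i - 1)"
    have \<delta>0: "\<delta> j = 0" if "j \<ge> n" for j using single(1) less.prems(1) that by (simp add: \<delta>_def)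
    have \<gamma>: "\<gamma> = inc i \<delta>" using single by (auto simp: \<delta>_def inc_def)
    have "\<phi> \<gamma> = r i * \<phi> (inc (a i) \<delta>)"
      using assms(1) single by (auto simp: solution_def recurrence_def \<gamma>)
    moreover have "\<phi> (inc (a i) \<delta>) = 0" if "r i \<noteq> 0"
      using single(1) a_less[of i] lev_a[of i] that \<delta>0
      by (intro IH) (simp_all add: wt deg \<gamma> supp)
    ultimately show ?thesis by auto
  next
    case double
    define \<delta> where "\<delta> = \<gamma>(i := \<gamma> i - 2)"
    have i: "i < n" using double X_less by auto
    have \<delta>0: "\<delta> j = 0" if "j \<ge> n" for j using i less.prems(1) that by (simp add: \<delta>_def)
    have \<gamma>: "\<gamma> = inc i (inc i \<delta>)" using double by (auto simp: \<delta>_def inc_def fun_eq_iff)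
    have "\<phi> \<gamma> = r i * \<phi> (inc i (inc (a i) \<delta>)) + s i * \<phi> (inc i (inc (b i) \<delta>))
       - r i * s i * \<phi> (inc (a i) (inc (b i) \<delta>))"
      using assms(1) double i by (auto simp: solution_def recurrence_def \<gamma>)
    moreover have "\<phi> (inc i (inc (a i) \<delta>)) = 0" "\<phi> (inc i (inc (b i) \<delta>)) = 0"
      "\<phi> (inc (a i) (inc (b i) \<delta>)) = 0"
      using double(1) i a_less[of i] b_less[of i] lev_a[of i] lev_b[of i] \<delta>0
      by (intro IH; simp add: wt deg \<gamma> supp)+
    ultimately show ?thesis by simp
  next
    case reduced
    define T where "T = {i. i < n \<and> \<gamma> i = 1}"
    have \<gamma>: "\<gamma> = set_index T"
    proof
      fix i show "\<gamma> i = set_index T i"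
        using reduced[of i] less.prems(1)[of i] by (cases "i < n") (auto simp: T_def set_index_def)
    qed
    have "card T = (\<Sum>i<n. \<gamma> i)"
      unfolding \<gamma> set_index_def by (simp add: sum.If_cases T_def Int_def)
    moreover have "T \<subseteq> X"
    proof
      fix i assume "i \<in> T" then show "i \<in> X" using reduced[of i] by (auto simp: T_def)
    qed
    ultimately show ?thesis using less.prems(2) \<gamma> by simp
  qed
qed

text \<open>No subset of \<open>X\<close> has more than \<open>card X\<close> elements, so in higher
  degrees the uniqueness statement leaves nothing to check. This makes a solution a differential
  operator of finite order.\<close>

lemma solution_finite_support:
  assumes "solution \<phi>" "\<And>i. i \<ge> n \<Longrightarrow> \<gamma> i = 0" "(\<Sum>i<n. \<gamma> i) > card X"
  shows "\<phi> \<gamma> = 0"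
proof (rule solution_unique[OF assms(1,2)])
  fix T assume "T \<subseteq> X" "card T = (\<Sum>i<n. \<gamma> i)"
  then show "\<phi> (set_index T) = 0"
    using assms(3) card_mono[OF finite_subset[OF X_less] \<open>T \<subseteq> X\<close>] by simp
qed

text \<open>
  The solution is built by adding the variables in the order of their levels: the coefficients of
  the powers of the new variable are obtained from the first one or two of them by shifting, and
  shifting preserves the recurrences of the other variables.
\<close>

lemma partial_solution_exists:
  assumes "finite Z" "Z \<subseteq> {..<n}"
  shows "\<exists>\<phi>. (\<forall>i\<in>Z. recurrence i \<phi>) \<and> (\<forall>T. T \<subseteq> X \<and> T \<subseteq> Z \<longrightarrow> \<phi> (set_index T) = f T)"
  using assms
proof (induction arbitrary: f rule: finite_ranking_induct[where f = lev])
  case empty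
  show ?case by (intro exI[of _ "\<lambda>_. f {}"]) auto
next
  case (insert v Z)
  show ?case
  proof (cases "v \<in> Z")
    case True
    then show ?thesis using insert.IH[of f] insert.prems by (simp add: insert_absorb)
  next
    case v: False
    have "v < n" using insert.prems by simp
    have Z: "Z \<subseteq> {..<n}" using insert.prems by simp
    obtain \<phi>0 where "\<forall>i\<in>Z. recurrence i \<phi>0"
      "\<forall>T. T \<subseteq> X \<and> T \<subseteq> Z \<longrightarrow> \<phi>0 (set_index T) = f T"
      using insert.IH[OF Z, of f] by (elim exE conjE)
    then have \<phi>0: "\<And>i. i \<in> Z \<Longrightarrow> recurrence i \<phi>0"
      "\<And>T. T \<subseteq> X \<Longrightarrow> T \<subseteq> Z \<Longrightarrow> \<phi>0 (set_index T) = f T" by simp_all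
    \<comment> \<open>The values at squarefree monomials containing \<open>v\<close> are prescribed
      through the coefficient of the first power of the new variable.\<close>
    obtain \<phi>1 where "\<forall>i\<in>Z. recurrence i \<phi>1"
      "\<forall>T. T \<subseteq> X \<and> T \<subseteq> Z \<longrightarrow> \<phi>1 (set_index T) = f (insert v T)"
      using insert.IH[OF Z, of "\<lambda>T. f (insert v T)"] by (elim exE conjE)
    then have \<phi>1: "\<And>i. i \<in> Z \<Longrightarrow> recurrence i \<phi>1"
      "\<And>T. T \<subseteq> X \<Longrightarrow> T \<subseteq> Z \<Longrightarrow> \<phi>1 (set_index T) = f (insert v T)" by simp_all
    \<comment> \<open>The recursion has order two, so the pair carries two consecutive
      coefficients.\<close>
    define h where "h = rec_nat (\<phi>0, \<phi>1) (\<lambda>_ (p, q). (q, \<lambda>\<gamma>. r v * q (inc (a v) \<gamma>) +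
      s v * q (inc (b v) \<gamma>) + (- r v * s v) * p (inc (a v) (inc (b v) \<gamma>))))"
    define k where "k = rec_nat \<phi>0 (\<lambda>_ p \<gamma>. r v * p (inc (a v) \<gamma>))"
    \<comment> \<open>\<open>g m\<close> is the coefficient function that belongs to the power
      \<open>m\<close> of the new variable.\<close>
    define g where "g m = (if v \<in> X then fst (h m) else k m)" for m
    have g0: "g 0 = \<phi>0" by (simp add: g_def h_def k_def)
    have g1: "g (Suc 0) = \<phi>1" if "v \<in> X" using that by (simp add: g_def h_def)
    have g_double: "g (Suc (Suc m)) = (\<lambda>\<gamma>. r v * g (Suc m) (inc (a v) \<gamma>) + s v * g (Suc m) (inc (b v) \<gamma>)
         + (- r v * s v) * g m (inc (a v) (inc (b v) \<gamma>)))" if "v \<in> X" for m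
      using that by (simp add: g_def h_def split_beta)
    have g_single: "g (Suc m) = (\<lambda>\<gamma>. r v * g m (inc (a v) \<gamma>))" if "v \<notin> X" for m
      using that by (simp add: g_def k_def)
    have rec_g: "recurrence i (g m)" if i: "i \<in> Z" for i m
    proof (cases "v \<in> X")
      case True
      have "recurrence i (g m) \<and> recurrence i (g (Suc m))"
      proof (induction m)
        case 0
        then show ?case using g0 g1[OF True] \<phi>0(1)[OF i] \<phi>1(1)[OF i] by simp
      next
        case (Suc m)
        then show ?case
          unfolding g_double[OF True] 
            by (intro conjI recurrence_add recurrence_scale recurrence_shift; elim conjE)
      qed
      then show ?thesis ..
    next
      case False
      then show ?thesis
        by (induction m)
          (simp_all add: g0 g_single \<phi>0(1)[OF i] recurrence_scale recurrence_shift)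
    qed
    define \<phi> where "\<phi> \<gamma> = g (\<gamma> v) (\<gamma>(v := 0))" for \<gamma>
    have \<phi>_other: "\<phi> (inc j \<gamma>) = g (\<gamma> v) (inc j (\<gamma>(v := 0)))" if "j \<noteq> v" for j \<gamma>
      using that by (simp add: \<phi>_def inc_upd inc_apply)
    have \<phi>_other2: "\<phi> (inc j (inc k \<gamma>)) = g (\<gamma> v) (inc j (inc k (\<gamma>(v := 0))))"
      if "j \<noteq> v" "k \<noteq> v" for j k \<gamma>
      using that by (simp add: \<phi>_def inc_upd inc_apply)
    have \<phi>_inc: "\<phi> (inc v \<gamma>) = g (Suc (\<gamma> v)) (\<gamma>(v := 0))" for \<gamma>
      by (simp add: \<phi>_def inc_upd_same inc_apply)
    have "recurrence i \<phi>" if i: "i \<in> Z" for i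
    proof -
      \<comment> \<open>The ranking induction adds \<open>v\<close> with maximal level, so
        \<open>v\<close> is not a parent of an earlier \<open>i\<close>, except as the dummy
        \<open>a i\<close> when \<open>r i = 0\<close>.\<close>
      have "i \<noteq> v" "lev i \<le> lev v" "i < n" using v i insert.hyps insert.prems by auto
      then have "a i \<noteq> v" if "i \<in> X \<or> r i \<noteq> 0" using lev_a[of i] that by auto
      moreover have "b i \<noteq> v" if "i \<in> X" using lev_b[OF that] \<open>lev i \<le> lev v\<close> by auto
      ultimately show ?thesis
        using rec_g[OF i] \<open>i \<noteq> v\<close> unfolding recurrence_def
        by (cases "r i = 0") (auto simp: \<phi>_other \<phi>_other2 inc_upd inc_apply)
    qed
    moreover have "recurrence v \<phi>"
    proof (cases "v \<in> X")
      case True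
      then have "a v \<noteq> v" "b v \<noteq> v" using lev_a[OF \<open>v < n\<close>] lev_b[of v] by auto
      then show ?thesis using True unfolding recurrence_def
        by (auto simp: \<phi>_inc \<phi>_other2 g_double inc_apply inc_upd inc_upd_same)
    next
      case False
      have "a v \<noteq> v" if "r v \<noteq> 0" using lev_a[OF \<open>v < n\<close>] that by auto
      then show ?thesis
        using False unfolding recurrence_def
        by (cases "r v = 0") (auto simp: \<phi>_inc \<phi>_other g_single)
    qed
    moreover have "\<phi> (set_index T) = f T" if T: "T \<subseteq> X" "T \<subseteq> insert v Z" for T
    proof (cases "v \<in> T")
      case True
      have "(set_index T)(v := 0) = set_index (T - {v})"
        by (auto simp: set_index_def fun_eq_iff)
      then have "\<phi> (set_index T) = \<phi>1 (set_index (T - {v}))"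
        using True T g1 by (auto simp: \<phi>_def set_index_def[of T v])
      also have "\<dots> = f (insert v (T - {v}))" using T by (intro \<phi>1) auto
      finally show ?thesis using True by (simp add: insert_absorb)
    next
      case False
      then have "(set_index T)(v := 0) = set_index T"
        by (auto simp: set_index_def fun_eq_iff)
      then have "\<phi> (set_index T) = \<phi>0 (set_index T)"
        using False g0 by (auto simp: \<phi>_def set_index_def[of T v])
      then show ?thesis using \<phi>0(2) False T by auto
    qed
    ultimately show ?thesis
      by (intro exI[of _ \<phi>]) simp
  qed
qed

lemma solution_exists:
  obtains \<phi> where "solution \<phi>" "\<And>T. T \<subseteq> X \<Longrightarrow> \<phi> (set_index T) = f T"
proof -
  have "\<exists>\<phi>. (\<forall>i\<in>{..<n}. recurrence i \<phi>) \<and> (\<forall>T. T \<subseteq> X \<and> T \<subseteq> {..<n} \<longrightarrow> \<phi> (set_index T) = f T)"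
    by (rule partial_solution_exists) auto
  then obtain \<phi> where \<phi>: "\<forall>i\<in>{..<n}. recurrence i \<phi>"
    "\<forall>T. T \<subseteq> X \<and> T \<subseteq> {..<n} \<longrightarrow> \<phi> (set_index T) = f T" by (elim exE conjE)
  show ?thesis
  proof (rule that)
    show "solution \<phi>" using \<phi>(1) by (simp add: solution_def)
    show "\<phi> (set_index T) = f T" if "T \<subseteq> X" for T
      using \<phi>(2) X_less that by blast
  qed
qed

end

lemma sum_fun_apply: "(\<Sum>x\<in>A. (f x :: 'a \<Rightarrow> complex)) y = (\<Sum>x\<in>A. f x y)"
  by (induction A rule: infinite_finite_induct) auto

text \<open>Restriction to \<open>K\<close> is a linear isomorphism of \<open>L\<close> onto the
  functions on \<open>K\<close>, and the preimages \<open>b x\<close> of the indicator functions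
  form a basis. Its spanning bounds the supremum from above, its independence from below.\<close>

lemma rank_eq_card:
  assumes "finite K"
    and diff: "\<And>c d. c \<in> L \<Longrightarrow> d \<in> L \<Longrightarrow> c - d \<in> L"
    and scale: "\<And>a c. c \<in> L \<Longrightarrow> cscale a c \<in> L"
    and surj: "\<And>f. \<exists>c\<in>L. \<forall>x\<in>K. c x = f x"
    and inj: "\<And>c. c \<in> L \<Longrightarrow> (\<And>x. x \<in> K \<Longrightarrow> c x = 0) \<Longrightarrow> c = 0"
  shows "(SUP B \<in> {B. B \<subseteq> L \<and> finite B \<and> cfun.independent B}. enat (card B)) = enat (card K)"
proof (rule antisym)
  obtain b where b: "\<And>x. b x \<in> L" "\<And>x y. y \<in> K \<Longrightarrow> b x y = (if y = x then 1 else 0)"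
    using surj[of "\<lambda>y. if y = x then 1 else 0" for x] by metis
  have add: "c + d \<in> L" if "c \<in> L" "d \<in> L" for c d
  proof -
    have "cscale (-1) d \<in> L" using that scale by blast
    from diff[OF that(1) this] show ?thesis by (simp add: cscale_def fun_diff_def plus_fun_def)
  qed
  have zero: "0 \<in> L" using diff[of "b undefined" "b undefined"] b(1) by simp
  have sum: "(\<Sum>x\<in>A. h x) \<in> L" if "\<And>x. x \<in> A \<Longrightarrow> h x \<in> L" for A :: "'a set" and h
    using that by (induction A rule: infinite_finite_induct) (auto intro: add zero)
  have span: "c \<in> cfun.span (b ` K)" if "c \<in> L" for c
  proof -
    have "c - (\<Sum>x\<in>K. cscale (c x) (b x)) = 0"
      using assms(1)
      by (intro inj diff that sum scale b(1)) (simp add: sum_fun_apply cscale_def b(2) sum.delta' if_distrib cong: if_cong)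
    then have "c = (\<Sum>x\<in>K. cscale (c x) (b x))" by simp
    moreover have "(\<Sum>x\<in>K. cscale (c x) (b x)) \<in> cfun.span (b ` K)"
      by (intro cfun.span_sum cfun.span_scale cfun.span_base) auto
    ultimately show ?thesis by simp
  qed
  show "(SUP B \<in> {B. B \<subseteq> L \<and> finite B \<and> cfun.independent B}. enat (card B)) \<le> enat (card K)"
  proof (rule SUP_least)
    fix B assume "B \<in> {B. B \<subseteq> L \<and> finite B \<and> cfun.independent B}"
    then have "card B \<le> card (b ` K)"
      using span cfun.independent_span_bound[of "b ` K" B] assms(1) by auto
    then show "enat (card B) \<le> enat (card K)"
      using card_image_le[OF assms(1), of b] by simp
  qed
  have inj_b: "inj_on b K"
    using b(2) by (metis inj_onI zero_neq_one)
  have "cfun.independent (b ` K)"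
  proof
    assume "cfun.dependent (b ` K)"
    then obtain u x where u: "x \<in> K" "u (b x) \<noteq> 0" "(\<Sum>y\<in>K. cscale (u (b y)) (b y)) = 0"
      using assms(1) inj_b by (auto simp: cfun.dependent_finite sum.reindex)
    have "(\<Sum>y\<in>K. cscale (u (b y)) (b y)) x = u (b x)"
      using u(1) assms(1) by (simp add: sum_fun_apply cscale_def b(2) sum.delta' if_distrib cong: if_cong)
    then show False using u by simp
  qed
  moreover have "b ` K \<subseteq> L" using b(1) by auto
  ultimately have "enat (card (b ` K)) \<le> (SUP B \<in> {B. B \<subseteq> L \<and> finite B \<and> cfun.independent B}. enat (card B))"
    using assms(1) by (intro SUP_upper) auto
  then show "enat (card K) \<le> (SUP B \<in> {B. B \<subseteq> L \<and> finite B \<and> cfun.independent B}. enat (card B))"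
    by (simp add: card_image[OF inj_b])
qed

section \<open>The ideal in the shuffle algebra\<close>

lemma Delta_Suc: "Delta (Suc n) z = Delta n z * (\<Prod>i<n. z i - z n)"
  by (simp add: Delta_def)

lemma Delta_comp_id: "(\<And>i. i < n \<Longrightarrow> \<sigma> i = i) \<Longrightarrow> Delta n (z \<circ> \<sigma>) = Delta n z"
  by (simp add: Delta_def)

text \<open>A transposition fixing the last variable is handled by induction, the adjacent one at
  the end directly. Any other transposition that moves the last variable is conjugate to the
  adjacent one by a transposition of the first kind.\<close>

lemma Delta_transpose:
  "a < b \<Longrightarrow> b < n \<Longrightarrow> Delta n (z \<circ> Transposition.transpose a b) = - Delta n z"
proof (induction n arbitrary: a b z)
  case (Suc n)
  have adj: "Delta (Suc (Suc m)) (z \<circ> Transposition.transpose m (Suc m)) = - Delta (Suc (Suc m)) z" for m z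
  proof -
    let ?t = "Transposition.transpose m (Suc m)"
    have "Delta m (z \<circ> ?t) = Delta m z"
      by (rule Delta_comp_id) (simp add: Transposition.transpose_def)
    moreover have "(\<Prod>i<m. (z \<circ> ?t) i - (z \<circ> ?t) j) = (\<Prod>i<m. z i - z (?t j))" for j
      by (rule prod.cong) (auto simp: Transposition.transpose_def)
    ultimately show ?thesis by (simp add: Delta_Suc algebra_simps)
  qed
  have lower: "Delta (Suc n) (z \<circ> Transposition.transpose a b) = - Delta (Suc n) z" if "a < b" "b < n" for a b z
  proof -
    have p: "Transposition.transpose a b permutes {..<n}" using that by (intro permutes_swap_id) auto
    have "(\<Prod>i<n. (z \<circ> Transposition.transpose a b) i - (z \<circ> Transposition.transpose a b) n) = (\<Prod>i<n. z (Transposition.transpose a b i) - z n)"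
      using that by (intro prod.cong) (auto simp: Transposition.transpose_def)
    also have "\<dots> = (\<Prod>i<n. z i - z n)"
      using prod.permute[OF p, of "\<lambda>i. z i - z n"] by (simp add: o_def)
    finally show ?thesis using Suc.IH[OF that, of z] by (simp only: Delta_Suc mult_minus_left)
  qed
  show ?case
  proof (cases "b < n")
    case True
    then show ?thesis using lower Suc.prems by blast
  next
    case False
    then have b: "b = n" using Suc.prems by simp
    then obtain m where n: "n = Suc m" using Suc.prems by (cases n) auto
    show ?thesis
    proof (cases "a = m")
      case True
      then show ?thesis using adj[of m z] by (simp only: b n)
    next
      case False
      then have a: "a < m" using Suc.prems b n by simp
      have "Transposition.transpose a b = Transposition.transpose a m \<circ> Transposition.transpose m (Suc m) \<circ> Transposition.transpose a m"
        using a b n by (auto simp: Transposition.transpose_def fun_eq_iff)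
      then have "z \<circ> Transposition.transpose a b = z \<circ> Transposition.transpose a m \<circ> Transposition.transpose m (Suc m) \<circ> Transposition.transpose a m"
        by (simp add: comp_assoc)
      then show ?thesis
        using lower[of a m "z \<circ> Transposition.transpose a m \<circ> Transposition.transpose m (Suc m)"]
          adj[of m "z \<circ> Transposition.transpose a m"] lower[of a m z] a n by (simp only: lessI minus_minus)
    qed
  qed
qed simp

lemma Delta_permute:
  assumes "\<sigma> permutes {..<n}"
  shows "Delta n (z \<circ> \<sigma>) = of_int (sign \<sigma>) * Delta n z"
proof -
  have "\<forall>z. Delta n (z \<circ> \<sigma>) = of_int (sign \<sigma>) * Delta n z"
    using assms finite_lessThan[of n]
  proof (induction rule: permutes_induct)
    case id
    then show ?case by (simp add: sign_id)
  next
    case (swap a b p)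
    have t: "Delta n (z \<circ> Transposition.transpose a b) = - Delta n z" for z
      using swap.hyps Delta_transpose[of a b n z] Delta_transpose[of b a n z]
      by (cases a b rule: linorder_cases) (auto simp: transpose_commute)
    have "sign (Transposition.transpose a b \<circ> p) = - sign p"
      using swap.hyps permutes_imp_permutation[of "{..<n}" p]
      by (simp add: sign_compose permutation_swap_id sign_swap_id)
    moreover have "Delta n (z \<circ> (Transposition.transpose a b \<circ> p)) = - of_int (sign p) * Delta n z" for z
      using swap.IH[rule_format, of "z \<circ> Transposition.transpose a b"] t[of z]
      by (simp only: comp_assoc mult_minus_left mult_minus_right)
    ultimately show ?case by (simp only: of_int_minus) blast
  qed
  then show ?thesis by blast
qed

text \<open>Splits off the first variable instead of the last: in a product whose left factor has
  degree 1, that factor takes variable 0.\<close>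

lemma Delta_shift:
  "Delta (Suc m) z = (\<Prod>j<m. z 0 - z (Suc j)) * Delta m (\<lambda>i. z (Suc i))"
proof (induction m)
  case (Suc m)
  have "Delta (Suc (Suc m)) z = Delta (Suc m) z * (\<Prod>i<Suc m. z i - z (Suc m))"
    by (rule Delta_Suc)
  also have "(\<Prod>i<Suc m. z i - z (Suc m)) = (z 0 - z (Suc m)) * (\<Prod>i<m. z (Suc i) - z (Suc m))"
    by (rule prod.lessThan_Suc_shift)
  also have "Delta (Suc m) z = (\<Prod>j<m. z 0 - z (Suc j)) * Delta m (\<lambda>i. z (Suc i))"
    by (rule Suc)
  finally show ?case
    by (simp add: Delta_Suc[of m "\<lambda>i. z (Suc i)"] mult_ac)
qed (simp add: Delta_def)

lemma Delta_polyfun: "Delta n \<in> polyfun n"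
  unfolding Delta_def[abs_def]
  by (rule polyfun_prod polyfun_diff polyfun_coord | simp)+

lemma Delta_nonzero: "z \<in> config n \<Longrightarrow> Delta n z \<noteq> 0"
  using config_distinct[of z n] by (force simp: Delta_def)

text \<open>Admits the interpolation polynomials as numerators of shuffle elements. Multiplication
  by \<open>z i\<close> shifts exponents injectively, so no coefficients have to be merged in that
  case.\<close>

lemma polyfun_laurent:
  assumes "f \<in> polyfun n"
  shows "f \<in> laurent n"
proof -
  have "\<exists>(E :: (nat \<Rightarrow> nat) set) c. finite E \<and> f = (\<lambda>z. \<Sum>e\<in>E. c e * (\<Prod>i<n. z i ^ e i))"
    using assms
  proof induction
    case (const a)
    show ?case by (intro exI[of _ "{\<lambda>_. 0}"] exI[of _ "\<lambda>_. a"]) simp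
  next
    case (add f g)
    then obtain E c E' c' where E: "finite E" "f = (\<lambda>z. \<Sum>e\<in>E. c e * (\<Prod>i<n. z i ^ e i))"
      and E': "finite E'" "g = (\<lambda>z. \<Sum>e\<in>E'. c' e * (\<Prod>i<n. z i ^ e i))"
      by blast
    have "(\<Sum>e\<in>E. c e * (\<Prod>i<n. z i ^ e i)) = (\<Sum>e\<in>E \<union> E'. (if e \<in> E then c e else 0) * (\<Prod>i<n. z i ^ e i))"
      "(\<Sum>e\<in>E'. c' e * (\<Prod>i<n. z i ^ e i)) = (\<Sum>e\<in>E \<union> E'. (if e \<in> E' then c' e else 0) * (\<Prod>i<n. z i ^ e i))" for z
      using E(1) E'(1) by (auto intro!: sum.mono_neutral_cong_left)
    then show ?case using E E'
      by (intro exI[of _ "E \<union> E'"]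
          exI[of _ "\<lambda>e. (if e \<in> E then c e else 0) + (if e \<in> E' then c' e else 0)"])
        (simp add: sum.distrib algebra_simps)
  next
    case (coord_mult f i)
    then obtain E c where E: "finite E" "f = (\<lambda>z. \<Sum>e\<in>E. c e * (\<Prod>i<n. z i ^ e i))"
      by blast
    let ?s = "\<lambda>e :: nat \<Rightarrow> nat. e(i := Suc (e i))"
    have inj: "inj_on ?s E"
    proof (rule inj_onI)
      fix e e' assume eq: "?s e = ?s e'"
      have "e j = e' j" for j
        using fun_cong[OF eq, of j] by (cases "j = i") auto
      then show "e = e'" by blast
    qed
    have shift: "z i * (\<Prod>j<n. z j ^ e j) = (\<Prod>j<n. z j ^ (?s e) j)" for z :: "nat \<Rightarrow> complex" and e
      using coord_mult.hyps(2) by (simp add: prod.remove[of "{..<n}" i])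
    have "(\<lambda>z. z i * f z) = (\<lambda>z. \<Sum>e\<in>E. c e * (\<Prod>j<n. z j ^ (?s e) j))"
      unfolding E(2) sum_distrib_left shift[symmetric] by (simp only: mult.left_commute)
    also have "\<dots> = (\<lambda>z. \<Sum>e\<in>?s ` E. c (e(i := e i - 1)) * (\<Prod>i<n. z i ^ e i))"
      by (simp add: sum.reindex[OF inj])
    finally have "(\<lambda>z. z i * f z) = (\<lambda>z. \<Sum>e\<in>?s ` E. c (e(i := e i - 1)) * (\<Prod>i<n. z i ^ e i))" .
    then show ?case
      by (intro exI[of _ "?s ` E"] exI[of _ "\<lambda>e. c (e(i := e i - 1))"] conjI finite_imageI E(1))
  qed
  then obtain E c where E: "finite E" "f = (\<lambda>z. \<Sum>e\<in>E. c e * (\<Prod>i<n. z i ^ e i))"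
    by (elim exE conjE)
  let ?t = "\<lambda>(e :: nat \<Rightarrow> nat) i. int (e i)"
  have inj: "inj_on ?t E" by (auto simp: inj_on_def fun_eq_iff)
  have "f = (\<lambda>z. \<Sum>e\<in>?t ` E. c (\<lambda>i. nat (e i)) * (\<Prod>i<n. z i powi e i))"
    by (simp add: sum.reindex[OF inj] E(2) power_int_of_nat)
  then show ?thesis
    unfolding laurent_def mem_Collect_eq
    by (intro exI[of _ "?t ` E"] exI[of _ "\<lambda>e. c (\<lambda>i. nat (e i))"] conjI finite_imageI E(1))
qed

lemma laurent_regular:
  assumes "f \<in> laurent n"
  shows "f \<in> regular n"
proof -
  have "(\<lambda>z. z i powi k) \<in> regular n" if "i < n" for i k
    by (cases "k \<ge> 0")
      (auto simp: power_int_def power_inverse[symmetric] config_nonzero[OF _ that]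
        intro!: regular_power regular.inverse regular.coord that)
  then show ?thesis
    using assms unfolding laurent_def
    by (auto intro!: regular_sum regular.mult regular.const regular_prod)
qed

lemma shuffle_component_regular:
  assumes "F \<in> shuffle_component n"
  shows "F \<in> regular n"
proof -
  from assms obtain f where f: "f \<in> laurent n"
    "F = (\<lambda>z. if z \<in> config n then f z / Delta n z else 0)"
    by (auto simp: shuffle_component_def)
  have "(\<lambda>z. f z * inverse (Delta n z)) \<in> regular n"
    by (intro regular.mult regular.inverse laurent_regular f polyfun_regular Delta_polyfun Delta_nonzero)
  then show ?thesis
    by (rule regular.cong) (simp add: f divide_inverse)
qed

lemma zero_shuffle_component: "0 \<in> shuffle_component n"
  unfolding shuffle_component_def mem_Collect_eq
  by (intro exI[of _ "\<lambda>_. 0"]) (auto simp: symmetric_fun_def polyfun_laurent polyfun.const fun_eq_iff)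

text \<open>The \<open>P_i\<close> of the overview. With \<open>z i\<close> alone in the left
  factor, the numerators of \<open>mu\<close> against all other variables multiply to the product
  here.\<close>

definition relator :: "complex \<Rightarrow> complex \<Rightarrow> complex \<Rightarrow> nat \<Rightarrow> nat \<Rightarrow> cfunc" where
  "relator q1 q2 l n i z = (z i - l) * (\<Prod>j\<in>{..<n} - {i}. (z i - q1 * z j) * (z i - q2 * z j))"

lemma bij_betw_permutes_remove:
  assumes "\<sigma> permutes S"
  shows "bij_betw \<sigma> (S - {i}) (S - {\<sigma> i})"
  by (simp add: bij_betw_def permutes_inj_on[OF assms] image_set_diff[OF permutes_inj[OF assms]]
      permutes_image[OF assms])

lemma relator_permute:
  assumes "\<sigma> permutes {..<n}"
  shows "relator q1 q2 l n i (z \<circ> \<sigma>) = relator q1 q2 l n (\<sigma> i) z"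
  using prod.reindex_bij_betw[OF bij_betw_permutes_remove[OF assms, of i],
      of "\<lambda>j. (z (\<sigma> i) - q1 * z j) * (z (\<sigma> i) - q2 * z j)"]
  by (simp add: relator_def)

lemma relator_polyfun: "i < n \<Longrightarrow> relator q1 q2 l n i \<in> polyfun n"
  unfolding relator_def[abs_def]
  by (rule polyfun_mult polyfun_prod polyfun_diff polyfun_coord polyfun.const | simp)+

text \<open>The multipliers are regular functions without any symmetry, so that the relators can be
  treated one at a time. The ideal is still stable under permutations, since these permute its
  generators.\<close>

definition relator_ideal :: "complex \<Rightarrow> complex \<Rightarrow> complex \<Rightarrow> nat \<Rightarrow> cfunc set" where
  "relator_ideal q1 q2 l n = {F. \<exists>h. (\<forall>i<n. h i \<in> regular n) \<and>
     (\<forall>z\<in>config n. F z = (\<Sum>i<n. relator q1 q2 l n i z * h i z))}"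

lemma relator_idealI:
  "(\<And>i. i < n \<Longrightarrow> h i \<in> regular n) \<Longrightarrow>
    (\<And>z. z \<in> config n \<Longrightarrow> F z = (\<Sum>i<n. relator q1 q2 l n i z * h i z)) \<Longrightarrow>
    F \<in> relator_ideal q1 q2 l n"
  unfolding relator_ideal_def mem_Collect_eq by (intro exI[of _ h]) simp

lemma relator_idealE:
  assumes "F \<in> relator_ideal q1 q2 l n"
  obtains h where "\<forall>i<n. h i \<in> regular n"
    "\<forall>z\<in>config n. F z = (\<Sum>i<n. relator q1 q2 l n i z * h i z)"
  using assms unfolding relator_ideal_def mem_Collect_eq by (elim exE conjE) (rule that)

lemma relator_ideal_zero: "(\<lambda>z. 0) \<in> relator_ideal q1 q2 l n"
  by (rule relator_idealI[of _ "\<lambda>_ _. 0"]) (auto intro: regular.const)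

lemma relator_ideal_add:
  assumes "F \<in> relator_ideal q1 q2 l n" "G \<in> relator_ideal q1 q2 l n"
  shows "(\<lambda>z. F z + G z) \<in> relator_ideal q1 q2 l n"
proof -
  from assms(1) obtain h where h': "\<forall>i<n. h i \<in> regular n"
    "\<forall>z\<in>config n. F z = (\<Sum>i<n. relator q1 q2 l n i z * h i z)" by (rule relator_idealE)
  note h = h'(1)[rule_format] h'(2)[rule_format]
  from assms(2) obtain k where k': "\<forall>i<n. k i \<in> regular n"
    "\<forall>z\<in>config n. G z = (\<Sum>i<n. relator q1 q2 l n i z * k i z)" by (rule relator_idealE)
  note k = k'(1)[rule_format] k'(2)[rule_format]
  show ?thesis
    by (rule relator_idealI[of _ "\<lambda>i z. h i z + k i z"])
      (auto intro: regular.add h k simp: h k sum.distrib algebra_simps)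
qed

lemma relator_ideal_sum:
  "(\<And>x. x \<in> A \<Longrightarrow> F x \<in> relator_ideal q1 q2 l n) \<Longrightarrow> (\<lambda>z. \<Sum>x\<in>A. F x z) \<in> relator_ideal q1 q2 l n"
  by (induction A rule: infinite_finite_induct) (auto intro: relator_ideal_zero relator_ideal_add)

lemma relator_ideal_scale:
  assumes "F \<in> relator_ideal q1 q2 l n"
  shows "(\<lambda>z. a * F z) \<in> relator_ideal q1 q2 l n"
proof -
  from assms(1) obtain h where h': "\<forall>i<n. h i \<in> regular n"
    "\<forall>z\<in>config n. F z = (\<Sum>i<n. relator q1 q2 l n i z * h i z)" by (rule relator_idealE)
  note h = h'(1)[rule_format] h'(2)[rule_format]
  show ?thesis
    by (rule relator_idealI[of _ "\<lambda>i z. a * h i z"])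
      (auto intro: regular.mult regular.const h simp: h sum_distrib_left algebra_simps)
qed

lemma relator_ideal_permute:
  assumes "F \<in> relator_ideal q1 q2 l n" and \<sigma>: "\<sigma> permutes {..<n}"
  shows "(\<lambda>z. F (z \<circ> \<sigma>)) \<in> relator_ideal q1 q2 l n"
proof -
  from assms(1) obtain h where h': "\<forall>i<n. h i \<in> regular n"
    "\<forall>z\<in>config n. F z = (\<Sum>i<n. relator q1 q2 l n i z * h i z)" by (rule relator_idealE)
  note h = h'(1)[rule_format] h'(2)[rule_format]
  have \<sigma>': "inv \<sigma> permutes {..<n}" by (rule permutes_inv[OF \<sigma>])
  have im: "inj_on \<sigma> {..<n}" "\<sigma> ` {..<n} \<subseteq> {..<n}"
    using permutes_inj_on[OF \<sigma>] permutes_image[OF \<sigma>] by auto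
  show ?thesis
  proof (rule relator_idealI[of _ "\<lambda>i z. h (inv \<sigma> i) (z \<circ> \<sigma>)"])
    show "(\<lambda>z. h (inv \<sigma> i) (z \<circ> \<sigma>)) \<in> regular n" if "i < n" for i
      using that permutes_in_image[OF \<sigma>', of i] by (intro regular_comp[OF _ im] h) simp
    fix z assume "z \<in> config n"
    then have "F (z \<circ> \<sigma>) = (\<Sum>i<n. relator q1 q2 l n (\<sigma> i) z * h i (z \<circ> \<sigma>))"
      by (simp add: h(2) config_comp[OF _ im] relator_permute[OF \<sigma>])
    also have "\<dots> = (\<Sum>i<n. relator q1 q2 l n i z * h (inv \<sigma> i) (z \<circ> \<sigma>))"
      using sum.permute[OF \<sigma>, of "\<lambda>i. relator q1 q2 l n i z * h (inv \<sigma> i) (z \<circ> \<sigma>)"]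
      by (simp add: o_def permutes_inverses(2)[OF \<sigma>])
    finally show "F (z \<circ> \<sigma>) = \<dots>" .
  qed
qed

lemma mu_regular:
  assumes "i < n" "j < n" "i \<noteq> j"
  shows "(\<lambda>z. mu q1 q2 (z i) (z j)) \<in> regular n"
proof -
  have "(\<lambda>z. (z i - q1 * z j) * (z i - q2 * z j) * inverse ((z i - z j) ^ 2)) \<in> regular n"
    using config_distinct[OF _ assms] assms
    by (intro regular.mult regular.inverse regular_diff regular_power regular.coord regular.const) auto
  then show ?thesis by (simp add: mu_def divide_inverse)
qed

text \<open>The \<open>mu (z i) (z j)\<close> with \<open>j\<close> among the new variables supply
  exactly the factors by which the relator in \<open>k + m\<close> variables exceeds the one in
  \<open>k\<close> variables. What remains is regular and goes into the multiplier
  \<open>H i\<close>.\<close>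

lemma relator_ideal_shuffle_prod:
  assumes "F \<in> relator_ideal q1 q2 l k" and G: "G \<in> regular m"
  shows "shuffle_prod q1 q2 k m F G \<in> relator_ideal q1 q2 l (k + m)"
proof -
  from assms(1) obtain h where h': "\<forall>i<k. h i \<in> regular k"
    "\<forall>z\<in>config k. F z = (\<Sum>i<k. relator q1 q2 l k i z * h i z)" by (rule relator_idealE)
  note h = h'(1)[rule_format] h'(2)[rule_format]
  let ?J = "{k..<k + m}"
  let ?H = "\<lambda>z. F z * G (\<lambda>i. z (k + i)) * (\<Prod>i<k. \<Prod>j\<in>?J. mu q1 q2 (z i) (z j))"
  define H where "H i z = (if i < k then h i z * G (\<lambda>i. z (k + i)) *
      ((\<Prod>i'\<in>{..<k} - {i}. \<Prod>j\<in>?J. mu q1 q2 (z i') (z j)) * (\<Prod>j\<in>?J. inverse ((z i - z j)^2))) else 0)"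
    for i z
  have shift: "(\<lambda>z. G (\<lambda>i. z (k + i))) \<in> regular (k + m)"
    using regular_comp[OF G, of "\<lambda>i. k + i" "k + m"] by (simp add: o_def image_subset_iff)
  have incl: "f \<in> regular (k + m)" if "f \<in> regular k" for f
    using regular_comp[OF that, of "\<lambda>i. i" "k + m"] by (simp add: o_def)
  have "?H \<in> relator_ideal q1 q2 l (k + m)"
  proof (rule relator_idealI[of _ H])
    fix i assume "i < k + m"
    have ne: "z i - z j \<noteq> 0" if "i < k" "j \<in> ?J" "z \<in> config (k + m)" for j z
      using config_distinct[OF that(3), of i j] that by auto
    show "H i \<in> regular (k + m)"
    proof (cases "i < k")
      case True
      have "(\<lambda>z. h i z * G (\<lambda>i. z (k + i)) * ((\<Prod>i'\<in>{..<k} - {i}. \<Prod>j\<in>?J. mu q1 q2 (z i') (z j)) *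
          (\<Prod>j\<in>?J. inverse ((z i - z j)^2)))) \<in> regular (k + m)"
        using True ne
        by (intro regular.mult shift incl h regular_prod mu_regular regular.inverse regular_power
            regular_diff regular.coord) auto
      then show ?thesis using True by (simp add: H_def[abs_def])
    qed (simp add: H_def[abs_def] regular.const)
  next
    fix z assume z: "z \<in> config (k + m)"
    have rel: "relator q1 q2 l k i z * (\<Prod>i'<k. \<Prod>j\<in>?J. mu q1 q2 (z i') (z j)) =
        relator q1 q2 l (k + m) i z * ((\<Prod>i'\<in>{..<k} - {i}. \<Prod>j\<in>?J. mu q1 q2 (z i') (z j)) *
          (\<Prod>j\<in>?J. inverse ((z i - z j)^2)))" if "i < k" for i
    proof -
      have un: "{..<k + m} - {i} = ({..<k} - {i}) \<union> ?J" using that by auto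
      have "relator q1 q2 l (k + m) i z = relator q1 q2 l k i z * (\<Prod>j\<in>?J. (z i - q1 * z j) * (z i - q2 * z j))"
        unfolding relator_def un by (subst prod.union_disjoint) (auto simp: mult.assoc)
      moreover have "(\<Prod>i'<k. \<Prod>j\<in>?J. mu q1 q2 (z i') (z j)) =
          (\<Prod>j\<in>?J. mu q1 q2 (z i) (z j)) * (\<Prod>i'\<in>{..<k} - {i}. \<Prod>j\<in>?J. mu q1 q2 (z i') (z j))"
        using that by (simp add: prod.remove)
      moreover have "(\<Prod>j\<in>?J. mu q1 q2 (z i) (z j)) =
          (\<Prod>j\<in>?J. (z i - q1 * z j) * (z i - q2 * z j)) * (\<Prod>j\<in>?J. inverse ((z i - z j)^2))"
        by (simp add: mu_def divide_inverse prod.distrib)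
      ultimately show ?thesis by (simp only: mult_ac)
    qed
    have "z \<in> config k" using config_comp[OF z, of "\<lambda>i. i" k] by (auto simp: o_def)
    then have "?H z = (\<Sum>i<k. (relator q1 q2 l k i z * (\<Prod>i'<k. \<Prod>j\<in>?J. mu q1 q2 (z i') (z j))) *
        (h i z * G (\<lambda>i. z (k + i))))"
      by (simp add: h(2) sum_distrib_left sum_distrib_right mult_ac)
    also have "\<dots> = (\<Sum>i<k. relator q1 q2 l (k + m) i z * H i z)"
      by (rule sum.cong) (simp_all add: rel H_def mult_ac)
    also have "\<dots> = (\<Sum>i<k + m. relator q1 q2 l (k + m) i z * H i z)"
      by (rule sum.mono_neutral_left) (auto simp: H_def)
    finally show "?H z = \<dots>" .
  qed
  then have summand: "(\<lambda>z. of_int (sign \<sigma>) * ?H (z \<circ> \<sigma>)) \<in> relator_ideal q1 q2 l (k + m)"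
    if "\<sigma> permutes {..<k + m}" for \<sigma>
    by (rule relator_ideal_scale[OF relator_ideal_permute[OF _ that]])
  show ?thesis
    unfolding shuffle_prod_def Alt_def[abs_def]
    by (rule relator_ideal_scale, rule relator_ideal_sum, rule summand) simp
qed

text \<open>Multiplication is only from the right, so the left factor always carries the relators.
  In degree 1 the product in the relator is empty, which leaves the generator's factor
  \<open>z 0 - l\<close>.\<close>

lemma ideal_component_relator_ideal:
  assumes "F \<in> ideal_component q1 q2 l n"
  shows "F \<in> relator_ideal q1 q2 l n"
proof -
  have "F n \<in> relator_ideal q1 q2 l n" if "F \<in> ideal_I q1 q2 l" for F n
    using that unfolding ideal_I_def
  proof (induction arbitrary: n rule: right_ideal_generated.induct)
    case (generator F)
    then obtain G where G: "G \<in> shuffle_component 1" "F = homogeneous 1 (\<lambda>z. (z 0 - l) * G z)"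
      by (auto simp: ideal_generators_def)
    show ?case
    proof (cases "n = 1")
      case True
      have "(\<lambda>z. (z 0 - l) * G z) \<in> relator_ideal q1 q2 l 1"
        by (rule relator_idealI[of _ "\<lambda>_. G"]) (use shuffle_component_regular[OF G(1)] in \<open>simp_all add: relator_def lessThan_Suc\<close>)
      then show ?thesis using True G by (simp add: homogeneous_def)
    next
      case False
      then show ?thesis using G relator_ideal_zero by (simp add: homogeneous_def zero_fun_def)
    qed
  next
    case zero
    then show ?case using relator_ideal_zero by (simp add: zero_fun_def)
  next
    case (add F G)
    then show ?case using relator_ideal_add[OF add.IH] by (simp add: plus_fun_def)
  next
    case (mult F G)
    have "shuffle_prod q1 q2 k (n - k) (F k) (G (n - k)) \<in> relator_ideal q1 q2 l n" if "k \<le> n" for k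
      using relator_ideal_shuffle_prod[OF mult.IH, of "G (n - k)" "n - k" k] mult.hyps(2)
        shuffle_component_regular that by (simp add: shuffle_algebra_def)
    then have "(\<lambda>z. \<Sum>k\<le>n. shuffle_prod q1 q2 k (n - k) (F k) (G (n - k)) z) \<in> relator_ideal q1 q2 l n"
      by (intro relator_ideal_sum) simp
    moreover have "(\<Sum>k\<in>A. f k) = (\<lambda>z. \<Sum>k\<in>A. f k z)" for A :: "nat set" and f :: "nat \<Rightarrow> cfunc"
      by (induction A rule: infinite_finite_induct) (auto simp: fun_eq_iff)
    ultimately show ?case by (simp add: shuffle_mult_def)
  qed
  then show ?thesis using assms by (auto simp: ideal_component_def)
qed

section \<open>Interpolation\<close>

text \<open>For \<open>i = 0\<close> this is the denominator of the unpermuted summand: the squares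
  from \<open>mu\<close> times the Vandermonde product of the remaining variables. In this form a
  permutation only moves \<open>i\<close> and contributes a sign.\<close>

definition pairing :: "nat \<Rightarrow> nat \<Rightarrow> cfunc" where
  "pairing n i z = Delta n z * (\<Prod>j\<in>{..<n} - {i}. z i - z j)"

lemma pairing_polyfun: "i < n \<Longrightarrow> pairing n i \<in> polyfun n"
  unfolding pairing_def[abs_def]
  by (rule polyfun_mult Delta_polyfun polyfun_prod polyfun_diff polyfun_coord | simp)+

lemma pairing_nonzero: "z \<in> config n \<Longrightarrow> i < n \<Longrightarrow> pairing n i z \<noteq> 0"
  using config_distinct[of z n i] Delta_nonzero[of z n] by (auto simp: pairing_def)

lemma pairing_permute:
  assumes "\<sigma> permutes {..<n}"
  shows "pairing n i (z \<circ> \<sigma>) = of_int (sign \<sigma>) * pairing n (\<sigma> i) z"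
  using prod.reindex_bij_betw[OF bij_betw_permutes_remove[OF assms, of i], of "\<lambda>j. z (\<sigma> i) - z j"]
  by (simp add: pairing_def Delta_permute[OF assms] del: o_apply) (simp add: o_def)

lemma homogeneous_shuffle_algebra:
  assumes "G \<in> shuffle_component m"
  shows "homogeneous m G \<in> shuffle_algebra"
proof -
  have "finite {n. homogeneous m G n \<noteq> 0}"
    by (rule finite_subset[of _ "{m}"]) (auto simp: homogeneous_def)
  then show ?thesis
    using assms by (simp add: shuffle_algebra_def homogeneous_def zero_shuffle_component)
qed

lemma shuffle_prod_zero_left: "shuffle_prod q1 q2 k m 0 G = 0"
  by (simp add: shuffle_prod_def Alt_def[abs_def] zero_fun_def)

lemma shuffle_mult_homogeneous:
  "shuffle_mult q1 q2 (homogeneous 1 F) (homogeneous m G) (Suc m) = shuffle_prod q1 q2 1 m F G"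
proof -
  have "shuffle_mult q1 q2 (homogeneous 1 F) (homogeneous m G) (Suc m) =
      (\<Sum>k\<le>Suc m. if k = 1 then shuffle_prod q1 q2 1 m F G else 0)"
    unfolding shuffle_mult_def
    by (rule sum.cong) (auto simp: homogeneous_def shuffle_prod_zero_left)
  then show ?thesis by simp
qed

text \<open>
  The symmetric function \<open>\<Prod>\<^sub>k r(z\<^sub>k)\<close> of all variables factors out of the product, so only the
  variable \<open>z\<^bsub>\<sigma> 0\<^esub>\<close> is distinguished in the summand of \<open>\<sigma>\<close>.
\<close>

lemma ideal_component_member:
  fixes e r :: "complex \<Rightarrow> complex"
  assumes e: "(\<lambda>z. e (z 0)) \<in> polyfun 1" and r: "\<And>m j. j < m \<Longrightarrow> (\<lambda>z. r (z j)) \<in> polyfun m"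
  shows "\<exists>F\<in>ideal_component q1 q2 l (Suc m). \<forall>z\<in>config (Suc m).
    F z = 1 / fact (Suc m) * (\<Sum>\<sigma> | \<sigma> permutes {..<Suc m}.
      relator q1 q2 l (Suc m) (\<sigma> 0) z * e (z (\<sigma> 0)) * (\<Prod>k<Suc m. r (z k)) *
        inverse (pairing (Suc m) (\<sigma> 0) z))"
proof -
  \<comment> \<open>\<open>r\<close> enters both factors: together they give the product of
    \<open>r\<close> over all variables, which is invariant under permutations.\<close>
  define G1 :: cfunc where "G1 = (\<lambda>z. if z \<in> config 1 then (e (z 0) * r (z 0)) / Delta 1 z else 0)"
  define G2 :: cfunc where "G2 = (\<lambda>z. if z \<in> config m then (\<Prod>k<m. r (z k)) / Delta m z else 0)"
  define F1 :: cfunc where "F1 = (\<lambda>z. (z 0 - l) * G1 z)"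
  have "symmetric_fun 1 (\<lambda>z. e (z 0) * r (z 0))"
    unfolding symmetric_fun_def
  proof (intro allI impI)
    fix \<sigma> :: "nat \<Rightarrow> nat" and z :: "nat \<Rightarrow> complex" assume "\<sigma> permutes {..<1}"
    then have "\<sigma> 0 = 0" using permutes_in_image[of \<sigma> "{..<1}" 0] by simp
    then show "e ((z \<circ> \<sigma>) 0) * r ((z \<circ> \<sigma>) 0) = e (z 0) * r (z 0)" by simp
  qed
  then have G1: "G1 \<in> shuffle_component 1"
    unfolding shuffle_component_def mem_Collect_eq
    using polyfun_laurent[OF polyfun_mult[OF e r]]
    by (intro exI[of _ "\<lambda>z. e (z 0) * r (z 0)"]) (simp add: G1_def)
  have "symmetric_fun m (\<lambda>z. \<Prod>k<m. r (z k))"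
    unfolding symmetric_fun_def
  proof (intro allI impI)
    fix \<sigma> :: "nat \<Rightarrow> nat" and z :: "nat \<Rightarrow> complex" assume "\<sigma> permutes {..<m}"
    from prod.permute[OF this, of "\<lambda>k. r (z k)"]
    show "(\<Prod>k<m. r ((z \<circ> \<sigma>) k)) = (\<Prod>k<m. r (z k))" by (simp add: o_def)
  qed
  moreover have "(\<lambda>z. \<Prod>k<m. r (z k)) \<in> laurent m"
    by (rule polyfun_laurent, rule polyfun_prod, rule r) simp
  ultimately have G2: "G2 \<in> shuffle_component m"
    unfolding shuffle_component_def mem_Collect_eq
    by (intro exI[of _ "\<lambda>z. \<Prod>k<m. r (z k)"]) (simp add: G2_def)
  have "homogeneous 1 F1 \<in> ideal_I q1 q2 l"
    unfolding ideal_I_def F1_def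
    by (rule right_ideal_generated.generator) (use G1 in \<open>auto simp: ideal_generators_def\<close>)
  then have "shuffle_mult q1 q2 (homogeneous 1 F1) (homogeneous m G2) \<in> ideal_I q1 q2 l"
    unfolding ideal_I_def
    by (rule right_ideal_generated.mult) (rule homogeneous_shuffle_algebra[OF G2])
  then have mem: "shuffle_prod q1 q2 1 m F1 G2 \<in> ideal_component q1 q2 l (Suc m)"
    unfolding ideal_component_def by (rule rev_image_eqI) (simp only: shuffle_mult_homogeneous)
  define H :: cfunc where
    "H z = F1 z * G2 (\<lambda>i. z (1 + i)) * (\<Prod>i<1. \<Prod>j\<in>{1..<1 + m}. mu q1 q2 (z i) (z j))" for z
  have H: "H z = relator q1 q2 l (Suc m) 0 z * e (z 0) * (\<Prod>k<Suc m. r (z k)) * inverse (pairing (Suc m) 0 z)"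
    if z: "z \<in> config (Suc m)" for z
  proof -
    have "z \<in> config 1" using config_comp[OF z, of "\<lambda>i. i" 1] by (simp add: o_def image_subset_iff)
    then have "F1 z = (z 0 - l) * (e (z 0) * r (z 0))"
      by (simp add: F1_def G1_def Delta_def)
    moreover have "(\<lambda>i. z (Suc i)) \<in> config m"
      using config_comp[OF z, of Suc m] by (simp add: o_def image_subset_iff)
    then have "G2 (\<lambda>i. z (1 + i)) = (\<Prod>k<m. r (z (Suc k))) * inverse (Delta m (\<lambda>i. z (Suc i)))"
      by (simp add: G2_def divide_inverse)
    moreover have ivl: "(\<Prod>j\<in>{1..<1 + m}. f j) = (\<Prod>j<m. f (Suc j))" for f :: "nat \<Rightarrow> complex"
      using prod.shift_bounds_nat_ivl[of f 0 1 m] by (simp add: atLeast0LessThan)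
    have one: "(\<Prod>i<1. f i) = f 0" for f :: "nat \<Rightarrow> complex" by simp
    have "(\<Prod>i<1. \<Prod>j\<in>{1..<1 + m}. mu q1 q2 (z i) (z j)) =
        (\<Prod>j<m. (z 0 - q1 * z (Suc j)) * (z 0 - q2 * z (Suc j))) *
        (inverse (\<Prod>j<m. z 0 - z (Suc j)) * inverse (\<Prod>j<m. z 0 - z (Suc j)))"
      unfolding one ivl
      by (simp add: mu_def divide_inverse prod.distrib power2_eq_square prod_inversef[symmetric] mult.assoc)
    moreover have rem: "(\<Prod>j\<in>{..<Suc m} - {0}. f j) = (\<Prod>j<m. f (Suc j))" for f :: "nat \<Rightarrow> complex"
    proof -
      have "{..<Suc m} - {0} = Suc ` {..<m}" by (auto simp: image_iff less_Suc_eq_0_disj)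
      then show ?thesis by (simp add: prod.reindex)
    qed
    have "relator q1 q2 l (Suc m) 0 z = (z 0 - l) * (\<Prod>j<m. (z 0 - q1 * z (Suc j)) * (z 0 - q2 * z (Suc j)))"
      by (simp add: relator_def rem)
    moreover have "inverse (pairing (Suc m) 0 z) = inverse (Delta m (\<lambda>i. z (Suc i))) *
        (inverse (\<Prod>j<m. z 0 - z (Suc j)) * inverse (\<Prod>j<m. z 0 - z (Suc j)))"
      by (simp add: pairing_def rem Delta_shift mult_ac)
    moreover have "(\<Prod>k<Suc m. r (z k)) = r (z 0) * (\<Prod>k<m. r (z (Suc k)))"
      by (rule prod.lessThan_Suc_shift)
    ultimately show ?thesis unfolding H_def by (simp only: mult_ac)
  qed
  have "shuffle_prod q1 q2 1 m F1 G2 z = 1 / fact (Suc m) * (\<Sum>\<sigma> | \<sigma> permutes {..<Suc m}.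
      relator q1 q2 l (Suc m) (\<sigma> 0) z * e (z (\<sigma> 0)) * (\<Prod>k<Suc m. r (z k)) *
        inverse (pairing (Suc m) (\<sigma> 0) z))" if z: "z \<in> config (Suc m)" for z
  proof -
    have "of_int (sign \<sigma>) * H (z \<circ> \<sigma>) = relator q1 q2 l (Suc m) (\<sigma> 0) z * e (z (\<sigma> 0)) *
        (\<Prod>k<Suc m. r (z k)) * inverse (pairing (Suc m) (\<sigma> 0) z)" if \<sigma>: "\<sigma> permutes {..<Suc m}" for \<sigma>
    proof -
      have "z \<circ> \<sigma> \<in> config (Suc m)"
        by (rule config_comp[OF z permutes_inj_on[OF \<sigma>]]) (simp add: permutes_image[OF \<sigma>])
      moreover have "(\<Prod>k<Suc m. r ((z \<circ> \<sigma>) k)) = (\<Prod>k<Suc m. r (z k))"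
        using prod.permute[OF \<sigma>, of "\<lambda>k. r (z k)"] by (simp add: o_def)
      \<comment> \<open>The sign of the alternation cancels against that of the permuted
        denominator.\<close>
      moreover have "of_int (sign \<sigma>) * inverse (of_int (sign \<sigma>) :: complex) = 1"
        by (simp add: sign_def)
      ultimately show ?thesis
        by (simp add: H relator_permute[OF \<sigma>] pairing_permute[OF \<sigma>] del: prod.lessThan_Suc)
    qed
    then show ?thesis
      unfolding shuffle_prod_def Alt_def H_def[symmetric] by simp
  qed
  then show ?thesis by (intro bexI[OF _ mem]) simp
qed

lemma vanishing_cong_mult:
  assumes "vanishing n p N (\<lambda>z. F z - F' z)" "vanishing n p N (\<lambda>z. G z - G' z)"
    "F' \<in> regular n" "G \<in> regular n"
  shows "vanishing n p N (\<lambda>z. F z * G z - F' z * G' z)"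
proof -
  have "vanishing n p N (\<lambda>z. (F z - F' z) * G z + (G z - G' z) * F' z)"
    by (intro vanishing.add vanishing_mult_regular assms)
  then show ?thesis by (simp add: algebra_simps)
qed

lemma vanishing_cong_prod:
  assumes "\<And>x. x \<in> A \<Longrightarrow> vanishing n p N (\<lambda>z. F x z - F' x z)"
    "\<And>x. x \<in> A \<Longrightarrow> F x \<in> regular n" "\<And>x. x \<in> A \<Longrightarrow> F' x \<in> regular n"
  shows "vanishing n p N (\<lambda>z. (\<Prod>x\<in>A. F x z) - (\<Prod>x\<in>A. F' x z))"
  using assms
proof (induction A rule: infinite_finite_induct)
  case (insert x A)
  have "vanishing n p N (\<lambda>z. F x z * (\<Prod>x\<in>A. F x z) - F' x z * (\<Prod>x\<in>A. F' x z))"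
    by (rule vanishing_cong_mult) (use insert in \<open>auto intro: regular_prod\<close>)
  then show ?case using insert.hyps by simp
qed (auto intro: vanishing.zero)

text \<open>
  Univariate polynomials that are congruent to 1 at one of the points \<open>p i\<close> and to 0 at the
  others, up to order \<open>N\<close>.
\<close>

definition separator :: "nat \<Rightarrow> (nat \<Rightarrow> complex) \<Rightarrow> nat \<Rightarrow> nat \<Rightarrow> complex \<Rightarrow> complex" where
  "separator n p N i t = 1 - (1 - (\<Prod>j\<in>{..<n} - {i}. ((t - p j) * inverse (p i - p j)) ^ N)) ^ N"

lemma separator_polyfun:
  assumes "k < m"
  shows "(\<lambda>z. separator n p N i (z k)) \<in> polyfun m"
  unfolding separator_def using assms
  by - (rule polyfun_prod polyfun_mult polyfun_power polyfun_diff polyfun_coord polyfun.const | simp)+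

text \<open>The inner product is 1 at \<open>p i\<close>, so its difference from 1 vanishes there,
  and the outer \<open>N\<close>-th power of this difference vanishes to order
  \<open>N\<close>.\<close>

lemma separator_same:
  assumes "i < n" "p \<in> config n"
  shows "vanishing n p N (\<lambda>z. separator n p N i (z i) - 1)"
proof -
  let ?b = "\<lambda>z. 1 - (\<Prod>j\<in>{..<n} - {i}. ((z i - p j) * inverse (p i - p j)) ^ N)"
  have "?b \<in> polyfun n" using assms
    by - (rule polyfun_prod polyfun_mult polyfun_power polyfun_diff polyfun_coord polyfun.const | simp)+
  moreover have "?b p = 0"
    using config_distinct[OF assms(2,1)] by simp
  ultimately have "vanishing n p 1 ?b" using polyfun_vanishing[of ?b n p] by simp
  then have "vanishing n p N (\<lambda>z. - (?b z ^ N))" by (intro vanishing_uminus vanishing_power)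
  then show ?thesis by (simp add: separator_def)
qed

text \<open>\<open>1 - (1 - x) ^ N\<close> is a multiple of \<open>x\<close>, and the inner product
  contains the \<open>N\<close>-th power of a factor vanishing at \<open>p a\<close>.\<close>

lemma separator_other:
  assumes "i < n" "a < n" "a \<noteq> i"
  shows "vanishing n p N (\<lambda>z. separator n p N i (z a))"
proof -
  let ?b = "\<lambda>z. \<Prod>j\<in>{..<n} - {i}. ((z a - p j) * inverse (p i - p j)) ^ N"
  have reg: "(\<lambda>z. \<Prod>j\<in>A. ((z a - p j) * inverse (p i - p j)) ^ N) \<in> regular n" for A using assms
    by - (rule polyfun_regular polyfun_prod polyfun_mult polyfun_power polyfun_diff polyfun_coord polyfun.const | simp)+
  have b: "?b = (\<lambda>z. (z a - p a) ^ N * (inverse (p i - p a) ^ N *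
      (\<Prod>j\<in>{..<n} - {i} - {a}. ((z a - p j) * inverse (p i - p j)) ^ N)))"
    using assms by (simp add: prod.remove[of "{..<n} - {i}" a] power_mult_distrib mult_ac)
  have "vanishing n p N (\<lambda>z. (z a - p a) ^ N)"
    by (intro vanishing_power vanishing_coord assms)
  then have "vanishing n p N ?b"
    unfolding b by (rule vanishing_mult_regular) (intro regular.mult regular.const reg)
  then have "vanishing n p N (\<lambda>z. ?b z * (\<Sum>k<N. (1 - ?b z) ^ k))"
    by (rule vanishing_mult_regular) (intro regular_sum regular_power regular_diff regular.const reg)
  moreover have "x * (\<Sum>k<N. (1 - x) ^ k) = 1 - (1 - x) ^ N" for x :: complex
    by (simp add: one_diff_power_eq)
  ultimately show ?thesis by (simp only: separator_def)
qed

text \<open>Complements the inclusion into \<open>relator_ideal\<close>: up to order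
  \<open>N\<close> and a nonzero constant, the component contains a single relator times a unit
  times any monomial.\<close>

lemma ideal_component_approx:
  assumes p: "p \<in> config n" and i: "i < n"
  obtains F K where "F \<in> ideal_component q1 q2 l n" "K \<noteq> 0"
    "vanishing n p N (\<lambda>z. F z - K * (relator q1 q2 l n i z * inverse (pairing n i z) * shifted_monomial n p \<gamma> z))"
proof -
  obtain m where n: "n = Suc m" using i by (cases n) auto
  \<comment> \<open>At \<open>p j\<close> this polynomial agrees with
    \<open>(t - p j) ^ \<gamma> j\<close> to order \<open>N\<close>, so the product of the
    \<open>r (z k)\<close> approximates the given monomial.\<close>
  define r where "r t = (\<Sum>j<n. separator n p N j t * (t - p j) ^ \<gamma> j)" for t
  \<comment> \<open>This factor leaves only the permutations with
    \<open>\<sigma> 0 = i\<close>.\<close>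
  define e where "e = separator n p N i"
  have r_poly: "(\<lambda>z. r (z j)) \<in> polyfun m" if "j < m" for j m
    unfolding r_def using that
    by - (rule polyfun_sum polyfun_mult separator_polyfun polyfun_power polyfun_diff polyfun_coord polyfun.const | simp)+
  have e_poly: "(\<lambda>z. e (z j)) \<in> polyfun m" if "j < m" for j m
    unfolding e_def by (rule separator_polyfun[OF that])
  have "\<exists>F\<in>ideal_component q1 q2 l n. \<forall>z\<in>config n. F z = 1 / fact n * (\<Sum>\<sigma> | \<sigma> permutes {..<n}.
      relator q1 q2 l n (\<sigma> 0) z * e (z (\<sigma> 0)) * (\<Prod>k<n. r (z k)) * inverse (pairing n (\<sigma> 0) z))"
    unfolding n by (rule ideal_component_member) (rule e_poly, simp, rule r_poly)
  then obtain F where F: "F \<in> ideal_component q1 q2 l n"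
    "\<forall>z\<in>config n. F z = 1 / fact n * (\<Sum>\<sigma> | \<sigma> permutes {..<n}.
      relator q1 q2 l n (\<sigma> 0) z * e (z (\<sigma> 0)) * (\<Prod>k<n. r (z k)) * inverse (pairing n (\<sigma> 0) z))"
    by (elim bexE)
  define B where "B a z = relator q1 q2 l n a z * inverse (pairing n a z)" for a z
  have B: "B a \<in> regular n" if "a < n" for a
    unfolding B_def[abs_def] using that
    by (intro regular.mult regular.inverse polyfun_regular relator_polyfun pairing_polyfun) (auto simp: pairing_nonzero)
  define R where "R z = (\<Prod>k<n. r (z k))" for z
  have R_reg: "R \<in> regular n"
    unfolding R_def[abs_def] by (rule polyfun_regular, rule polyfun_prod, rule r_poly) simp
  have "vanishing n p N (\<lambda>z. r (z k) - (z k - p k) ^ \<gamma> k)" if k: "k < n" for k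
  proof -
    have pw: "(\<lambda>z. (z k - p j) ^ \<gamma> j) \<in> regular n" for j
      by (intro regular_power regular_diff regular.coord regular.const k)
    have "vanishing n p N (\<lambda>z. (separator n p N k (z k) - 1) * (z k - p k) ^ \<gamma> k)"
      by (intro vanishing_mult_regular separator_same k p pw)
    moreover have "vanishing n p N (\<lambda>z. \<Sum>j\<in>{..<n} - {k}. separator n p N j (z k) * (z k - p j) ^ \<gamma> j)"
      by (intro vanishing_sum vanishing_mult_regular separator_other pw) (use k in auto)
    ultimately have "vanishing n p N (\<lambda>z. (separator n p N k (z k) - 1) * (z k - p k) ^ \<gamma> k +
        (\<Sum>j\<in>{..<n} - {k}. separator n p N j (z k) * (z k - p j) ^ \<gamma> j))"
      by (rule vanishing.add)
    then show ?thesis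
      using k by (simp add: r_def sum.remove[of "{..<n}" k] algebra_simps)
  qed
  then have R: "vanishing n p N (\<lambda>z. R z - shifted_monomial n p \<gamma> z)"
    unfolding R_def shifted_monomial_def
    by (intro vanishing_cong_prod)
      (auto intro!: polyfun_regular r_poly polyfun_power polyfun_diff polyfun_coord polyfun.const)
  have main: "vanishing n p N (\<lambda>z. B i z * e (z i) * R z - B i z * shifted_monomial n p \<gamma> z)"
  proof -
    have "vanishing n p N (\<lambda>z. (e (z i) - 1) * (R z * B i z) + (R z - shifted_monomial n p \<gamma> z) * B i z)"
      using separator_same[OF i p, of N] i
      by (intro vanishing.add vanishing_mult_regular R B regular.mult R_reg) (simp_all add: e_def)
    then show ?thesis by (simp add: algebra_simps)
  qed
  have other: "vanishing n p N (\<lambda>z. B a z * e (z a) * R z)" if "a < n" "a \<noteq> i" for a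
  proof -
    have "vanishing n p N (\<lambda>z. e (z a) * (B a z * R z))"
      unfolding e_def using that i by (intro vanishing_mult_regular separator_other regular.mult B R_reg)
    then show ?thesis by (simp add: mult_ac)
  qed
  define P where "P = {\<sigma>. \<sigma> permutes {..<n} \<and> \<sigma> 0 = i}"
  \<comment> \<open>One contributing permutation suffices for a nonzero constant: all contributions
    agree to order \<open>N\<close>, so they cannot cancel.\<close>
  have "Transposition.transpose 0 i \<in> P"
    using i by (auto simp: P_def intro!: permutes_swap_id)
  moreover have fin: "finite {\<sigma>. \<sigma> permutes {..<n}}" by (rule finite_permutations) simp
  moreover from this have "finite P" by (rule rev_finite_subset) (auto simp: P_def)
  ultimately have K: "of_nat (card P) / (fact n :: complex) \<noteq> 0" by auto
  have "vanishing n p N (\<lambda>z. \<Sum>\<sigma> | \<sigma> permutes {..<n}. B (\<sigma> 0) z * e (z (\<sigma> 0)) * R z -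
      (if \<sigma> \<in> P then B i z * shifted_monomial n p \<gamma> z else 0))"
  proof (rule vanishing_sum)
    fix \<sigma> assume "\<sigma> \<in> {\<sigma>. \<sigma> permutes {..<n}}"
    then have \<sigma>: "\<sigma> permutes {..<n}" by simp
    then have "\<sigma> 0 < n" using permutes_in_image[of \<sigma> "{..<n}" 0] n by simp
    then show "vanishing n p N (\<lambda>z. B (\<sigma> 0) z * e (z (\<sigma> 0)) * R z -
      (if \<sigma> \<in> P then B i z * shifted_monomial n p \<gamma> z else 0))"
      using main other[of "\<sigma> 0"] \<sigma> by (cases "\<sigma> 0 = i") (simp_all add: P_def)
  qed
  from vanishing_mult_regular[OF this regular.const[of "1 / fact n"]]
  have "vanishing n p N (\<lambda>z. F z - of_nat (card P) / fact n *
    (relator q1 q2 l n i z * inverse (pairing n i z) * shifted_monomial n p \<gamma> z))"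
  proof (rule vanishing.cong)
    fix z assume z: "z \<in> config n"
    have "(\<Sum>\<sigma> | \<sigma> permutes {..<n}. if \<sigma> \<in> P then B i z * shifted_monomial n p \<gamma> z else 0) =
        (\<Sum>\<sigma>\<in>P. B i z * shifted_monomial n p \<gamma> z)"
      using fin by (intro sum.mono_neutral_cong_right) (auto simp: P_def)
    moreover have "F z = 1 / fact n * (\<Sum>\<sigma> | \<sigma> permutes {..<n}. B (\<sigma> 0) z * e (z (\<sigma> 0)) * R z)"
      unfolding F(2)[rule_format, OF z] B_def R_def by (simp add: mult_ac)
    ultimately show "(\<Sum>\<sigma> | \<sigma> permutes {..<n}. B (\<sigma> 0) z * e (z (\<sigma> 0)) * R z -
        (if \<sigma> \<in> P then B i z * shifted_monomial n p \<gamma> z else 0)) * (1 / fact n) =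
      F z - of_nat (card P) / fact n *
        (relator q1 q2 l n i z * inverse (pairing n i z) * shifted_monomial n p \<gamma> z)"
      by (simp add: sum_subtractf B_def algebra_simps)
  qed
  with F(1) K show ?thesis by (rule that)
qed

section \<open>Trees\<close>

text \<open>The edge set is the graph of a choice of one parent for each vertex other than the root,
  and these choices are independent.\<close>

lemma card_trees_on:
  assumes "finite Y" "(0, 0) \<in> Y"
  shows "card (trees_on Y) = (\<Prod>v\<in>Y - {(0, 0)}. card {w \<in> Y. grid_parent v w})"
proof -
  let ?S = "Y - {(0, 0)}" and ?P = "\<lambda>v. {w \<in> Y. grid_parent v w}"
  let ?g = "\<lambda>f. (\<lambda>v. (v, f v)) ` ?S"
  have "bij_betw ?g (PiE ?S ?P) (trees_on Y)"
  proof (rule bij_betw_imageI)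
    show "inj_on ?g (PiE ?S ?P)"
    proof (rule inj_onI)
      fix f g assume fg: "f \<in> PiE ?S ?P" "g \<in> PiE ?S ?P" and eq: "?g f = ?g g"
      from fg show "f = g"
      proof (rule PiE_ext)
        fix v assume "v \<in> ?S"
        then have "(v, f v) \<in> ?g g" unfolding eq[symmetric] by (rule imageI)
        then show "f v = g v" by auto
      qed
    qed
    show "?g ` PiE ?S ?P = trees_on Y"
    proof (intro equalityI subsetI)
      fix T assume "T \<in> ?g ` PiE ?S ?P"
      then obtain f where f: "f \<in> PiE ?S ?P" "T = ?g f" by blast
      have fv: "f v \<in> Y" "grid_parent v (f v)" if "v \<in> ?S" for v
        using PiE_mem[OF f(1) that] by simp_all
      have T_iff: "(v, w) \<in> T \<longleftrightarrow> v \<in> ?S \<and> w = f v" for v w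
        unfolding f(2) by blast
      show "T \<in> trees_on Y"
        unfolding trees_on_def
      proof (intro CollectI conjI assms(2) ballI)
        fix x assume "x \<in> T"
        then show "case x of (v, w) \<Rightarrow> v \<in> Y \<and> w \<in> Y \<and> grid_parent v w"
          using fv by (cases x) (simp add: T_iff)
      next
        fix v assume "v \<in> ?S"
        then show "\<exists>!w. (v, w) \<in> T" unfolding T_iff by blast
      qed
    next
      fix T assume T: "T \<in> trees_on Y"
      then have edge: "v \<in> Y" "w \<in> Y" "grid_parent v w" if "(v, w) \<in> T" for v w
        using that by (auto simp: trees_on_def)
      have ex1: "\<exists>!w. (v, w) \<in> T" if "v \<in> ?S" for v
        using T that by (auto simp: trees_on_def)
      define f where "f = restrict (\<lambda>v. THE w. (v, w) \<in> T) ?S"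
      have fT: "(v, f v) \<in> T" if "v \<in> ?S" for v
        using theI'[OF ex1[OF that]] that by (simp add: f_def)
      have "T = ?g f"
      proof (intro equalityI subsetI)
        fix x assume "x \<in> T"
        then obtain v w where x: "x = (v, w)" "(v, w) \<in> T" by (cases x) auto
        \<comment> \<open>The root is a child of no vertex: a child has a positive
          coordinate.\<close>
        have "v \<in> ?S" using edge[OF x(2)] by (auto simp: grid_parent_def)
        then have "f v = w" using ex1 fT x by blast
        then show "x \<in> ?g f" using \<open>v \<in> ?S\<close> x by blast
      next
        fix x assume "x \<in> ?g f"
        then show "x \<in> T" using fT by blast
      qed
      moreover have "f \<in> PiE ?S ?P"
        using edge[OF fT] by (auto simp: f_def)
      ultimately show "T \<in> ?g ` PiE ?S ?P" by blast
    qed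
  qed
  from bij_betw_same_card[OF this] show ?thesis
    using assms by (simp add: card_PiE)
qed

text \<open>The guard excludes truncated subtraction, which would return \<open>v\<close> itself
  when its first coordinate is 0.\<close>

definition left_parent :: "(nat \<times> nat) set \<Rightarrow> nat \<times> nat \<Rightarrow> bool" where
  "left_parent Y v \<longleftrightarrow> fst v > 0 \<and> (fst v - 1, snd v) \<in> Y"

definition right_parent :: "(nat \<times> nat) set \<Rightarrow> nat \<times> nat \<Rightarrow> bool" where
  "right_parent Y v \<longleftrightarrow> snd v > 0 \<and> (fst v, snd v - 1) \<in> Y"

lemma double_parent_vertices_eq:
  "double_parent_vertices Y = {v \<in> Y. left_parent Y v \<and> right_parent Y v}"
  by (auto simp: double_parent_vertices_def left_parent_def right_parent_def)

lemma grid_parent_iff: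
  "grid_parent v w \<longleftrightarrow>
    fst v > 0 \<and> w = (fst v - 1, snd v) \<or> snd v > 0 \<and> w = (fst v, snd v - 1)"
  unfolding grid_parent_def prod_eq_iff fst_conv snd_conv by linarith

lemma card_grid_parents:
  "card {w \<in> Y. grid_parent v w} = of_bool (left_parent Y v) + of_bool (right_parent Y v)"
proof -
  let ?L = "if left_parent Y v then {(fst v - 1, snd v)} else {}"
  let ?R = "if right_parent Y v then {(fst v, snd v - 1)} else {}"
  have "{w \<in> Y. grid_parent v w} = ?L \<union> ?R"
    by (auto simp: grid_parent_iff left_parent_def right_parent_def)
  moreover have "?L \<inter> ?R = {}" by (auto simp: left_parent_def)
  moreover have "finite ?L" "finite ?R" by auto
  ultimately have "card {w \<in> Y. grid_parent v w} = card ?L + card ?R"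
    by (simp only: card_Un_disjoint)
  then show ?thesis by simp
qed

text \<open>A non-root vertex contributes a factor 0, 1 or 2, and 2 exactly for the vertices with
  both parents.\<close>

lemma card_trees_on_eq:
  assumes "finite Y" "(0, 0) \<in> Y"
  shows "card (trees_on Y) =
    (if \<forall>v\<in>Y - {(0, 0)}. left_parent Y v \<or> right_parent Y v then 2 ^ card (double_parent_vertices Y) else 0)"
proof (cases "\<forall>v\<in>Y - {(0, 0)}. left_parent Y v \<or> right_parent Y v")
  case True
  let ?X = "double_parent_vertices Y"
  have X: "?X \<subseteq> Y - {(0, 0)}" by (auto simp: double_parent_vertices_def)
  have "card (trees_on Y) = (\<Prod>v\<in>Y - {(0, 0)}. if v \<in> ?X then 2 else 1)"
    unfolding card_trees_on[OF assms] card_grid_parents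
    by (rule prod.cong) (use True in \<open>auto simp: double_parent_vertices_eq\<close>)
  also have "\<dots> = (\<Prod>v\<in>?X. 2)"
    using assms(1) X by (intro prod.mono_neutral_cong_right) auto
  finally show ?thesis using True by simp
next
  case False
  then show ?thesis
    using assms(1) by (auto simp: card_trees_on[OF assms] card_grid_parents)
qed

text \<open>A quotient of two coordinates may have exponents of either sign, so genericity is
  applied with integer exponents. The result puts the point into \<open>config n\<close> and decides
  which factors of the relators vanish there.\<close>

lemma vertex_coord_eq_iff:
  assumes "generic q1 q2" "l \<noteq> 0"
  shows "vertex_coord q1 q2 l u = vertex_coord q1 q2 l w \<longleftrightarrow> u = w"
proof
  assume eq: "vertex_coord q1 q2 l u = vertex_coord q1 q2 l w"
  have q: "q1 \<noteq> 0" "q2 \<noteq> 0" using assms(1) by (auto simp: generic_def)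
  have "q1 ^ fst u * q2 ^ snd u = q1 ^ fst w * q2 ^ snd w"
    using eq assms(2) by (simp add: vertex_coord_def)
  then have "q1 powi (int (fst u) - int (fst w)) * q2 powi (int (snd u) - int (snd w)) = 1"
    using q by (simp add: power_int_diff field_simps)
  then have "int (fst u) - int (fst w) = 0 \<and> int (snd u) - int (snd w) = 0"
    using assms(1) unfolding generic_def by (metis prod.inject)
  then show "u = w" by (simp add: prod_eq_iff)
qed simp

section \<open>Splitting off the factors that vanish at the point\<close>

definition leading_relator :: "complex \<Rightarrow> complex \<Rightarrow> complex \<Rightarrow> nat \<Rightarrow> (nat \<Rightarrow> complex) \<Rightarrow> nat \<Rightarrow> cfunc" where
  "leading_relator q1 q2 l n p i z = (if p i = l then z i - l else 1) *
     ((\<Prod>j | j < n \<and> j \<noteq> i \<and> p i = q1 * p j. z i - q1 * z j) *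
      (\<Prod>j | j < n \<and> j \<noteq> i \<and> p i = q2 * p j. z i - q2 * z j))"

text \<open>\<open>u\<close> collects the factors that do not vanish at \<open>p\<close>; such a
  polynomial is invertible there to any order and can be divided out.\<close>

lemma relator_factorization:
  assumes "i < n"
  obtains u where "u \<in> polyfun n" "u p \<noteq> 0"
    "\<And>z. relator q1 q2 l n i z = leading_relator q1 q2 l n p i z * u z"
proof
  define u :: cfunc where "u z = (if p i = l then 1 else z i - l) *
     ((\<Prod>j | j < n \<and> j \<noteq> i \<and> p i \<noteq> q1 * p j. z i - q1 * z j) *
      (\<Prod>j | j < n \<and> j \<noteq> i \<and> p i \<noteq> q2 * p j. z i - q2 * z j))" for z
  show "u \<in> polyfun n"
    unfolding u_def[abs_def] using assms
    by (cases "p i = l")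
      (simp_all, (rule polyfun_mult polyfun_prod polyfun_diff polyfun_coord polyfun.const | simp)+)
  show "u p \<noteq> 0"
    by (auto simp: u_def)
  show "relator q1 q2 l n i z = leading_relator q1 q2 l n p i z * u z" for z
  proof -
    have split: "(\<Prod>j\<in>{..<n} - {i}. f j) = (\<Prod>j | j < n \<and> j \<noteq> i \<and> P j. f j) *
        (\<Prod>j | j < n \<and> j \<noteq> i \<and> \<not> P j. f j)" for f :: "nat \<Rightarrow> complex" and P
      by (subst prod.union_disjoint[symmetric]) (auto intro!: prod.cong)
    show ?thesis
      unfolding relator_def leading_relator_def u_def prod.distrib
        split[where P = "\<lambda>j. p i = q1 * p j" and f = "\<lambda>j. z i - q1 * z j"]
        split[where P = "\<lambda>j. p i = q2 * p j" and f = "\<lambda>j. z i - q2 * z j"]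
      by simp
  qed
qed

lemma leading_relator_polyfun: "i < n \<Longrightarrow> leading_relator q1 q2 l n p i \<in> polyfun n"
  unfolding leading_relator_def[abs_def]
  by (cases "p i = l")
    (simp_all, (rule polyfun_mult polyfun_prod polyfun_diff polyfun_coord polyfun.const | simp)+)

section \<open>The relations as solutions of the recurrences\<close>

lemma regular_pairing_inverse: "i < n \<Longrightarrow> (\<lambda>z. inverse (pairing n i z)) \<in> regular n"
  by (intro regular.inverse polyfun_regular pairing_polyfun pairing_nonzero)

text \<open>An element of the component is a combination of relators whose regular multipliers may
  be replaced by polynomials, hence by monomials. Conversely, the approximating elements of the
  component give each relator times a unit, which is divided out to the order that \<open>c\<close>
  can see.\<close>

lemma relation_iff_leading:
  assumes p: "p \<in> config n" and c: "finite {\<alpha>. c \<alpha> \<noteq> 0}"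
  shows "(\<forall>F\<in>ideal_component q1 q2 l n. jet_functional n p c F = 0) \<longleftrightarrow>
    (\<forall>i<n. \<forall>\<gamma>. jet_functional n p c (\<lambda>z. leading_relator q1 q2 l n p i z * shifted_monomial n p \<gamma> z) = 0)"
    (is "?L \<longleftrightarrow> ?R")
proof -
  obtain N where N: "\<And>F. vanishing n p N F \<Longrightarrow> jet_functional n p c F = 0"
    using jet_functional_vanishing[OF c p] by blast
  have cong: "jet_functional n p c F = jet_functional n p c G"
    if "vanishing n p N (\<lambda>z. F z - G z)" "F \<in> regular n" "G \<in> regular n" for F G
    using N[OF that(1)] jet_functional_diff[OF p that(2,3)] by simp
  have lead: "leading_relator q1 q2 l n p i \<in> regular n" if "i < n" for i
    by (intro polyfun_regular leading_relator_polyfun that)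
  have rel: "relator q1 q2 l n i \<in> regular n" if "i < n" for i
    by (intro polyfun_regular relator_polyfun that)
  show ?thesis
  proof
    assume R: ?R
    show ?L
    proof
      fix F assume "F \<in> ideal_component q1 q2 l n"
      then have "F \<in> relator_ideal q1 q2 l n" by (rule ideal_component_relator_ideal)
      then obtain h where h: "\<forall>i<n. h i \<in> regular n"
        "\<forall>z\<in>config n. F z = (\<Sum>i<n. relator q1 q2 l n i z * h i z)" by (rule relator_idealE)
      have h_reg: "h i \<in> regular n" if "i < n" for i using h(1) that by simp
      have reg: "(\<lambda>z. relator q1 q2 l n i z * h i z) \<in> regular n" if "i < n" for i
        by (intro regular.mult rel h_reg that)
      have zero: "jet_functional n p c (\<lambda>z. relator q1 q2 l n i z * h i z) = 0" if i: "i < n" for i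
      proof -
        obtain f where f: "f \<in> polyfun n" "vanishing n p N (\<lambda>z. h i z - f z)"
          using regular_approx[OF h_reg[OF i] p, of N] by (elim bexE)
        obtain u where u: "u \<in> polyfun n"
          "\<And>z. relator q1 q2 l n i z = leading_relator q1 q2 l n p i z * u z"
          using relator_factorization[OF i] by metis
        have "vanishing n p N (\<lambda>z. (h i z - f z) * relator q1 q2 l n i z)"
          by (rule vanishing_mult_regular[OF f(2) rel[OF i]])
        then have "vanishing n p N (\<lambda>z. relator q1 q2 l n i z * h i z - relator q1 q2 l n i z * f z)"
          by (simp add: algebra_simps)
        from cong[OF this reg[OF i] regular.mult[OF rel[OF i] polyfun_regular[OF f(1)]]]
        have "jet_functional n p c (\<lambda>z. relator q1 q2 l n i z * h i z) =
            jet_functional n p c (\<lambda>z. leading_relator q1 q2 l n p i z * (u z * f z))"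
          by (simp add: u(2) mult.assoc)
        also have "\<dots> = 0"
          by (rule jet_functional_polyfun_zeroI[OF p lead[OF i] polyfun_mult[OF u(1) f(1)]]) (use R i in simp)
        finally show ?thesis .
      qed
      have "jet_functional n p c F = jet_functional n p c (\<lambda>z. \<Sum>i<n. relator q1 q2 l n i z * h i z)"
        using h(2) reg by (intro jet_functional_cong[OF p, symmetric] regular_sum) auto
      also have "\<dots> = (\<Sum>i<n. jet_functional n p c (\<lambda>z. relator q1 q2 l n i z * h i z))"
        using reg by (intro jet_functional_sum[OF p]) auto
      also have "\<dots> = 0" by (simp add: zero)
      finally show "jet_functional n p c F = 0" .
    qed
  next
    assume L: ?L
    show ?R
    proof (intro allI impI)
      fix i \<gamma> assume i: "i < n"
      define B where "B z = relator q1 q2 l n i z * inverse (pairing n i z)" for z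
      have B: "B \<in> regular n"
        unfolding B_def[abs_def] by (intro regular.mult rel regular_pairing_inverse i)
      have mono: "shifted_monomial n p \<delta> \<in> regular n" for \<delta>
        by (intro polyfun_regular shifted_monomial_polyfun)
      have zero: "jet_functional n p c (\<lambda>z. B z * shifted_monomial n p \<delta> z) = 0" for \<delta>
      proof -
        obtain F K where F: "F \<in> ideal_component q1 q2 l n" "K \<noteq> 0"
          "vanishing n p N (\<lambda>z. F z - K * (B z * shifted_monomial n p \<delta> z))"
          unfolding B_def by (rule ideal_component_approx[OF p i])
        have BM: "(\<lambda>z. B z * shifted_monomial n p \<delta> z) \<in> regular n"
          by (intro regular.mult B mono)
        have KBM: "(\<lambda>z. K * (B z * shifted_monomial n p \<delta> z)) \<in> regular n"
          by (intro regular.mult[OF regular.const] BM)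
        have "(\<lambda>z. (F z - K * (B z * shifted_monomial n p \<delta> z)) + K * (B z * shifted_monomial n p \<delta> z)) \<in> regular n"
          by (rule regular.add[OF vanishing_regular[OF F(3)] KBM])
        then have "F \<in> regular n" by simp
        from cong[OF F(3) this KBM] have "K * jet_functional n p c (\<lambda>z. B z * shifted_monomial n p \<delta> z) = 0"
          using L F(1) by (simp add: jet_functional_scale[OF p BM])
        then show ?thesis using F(2) by simp
      qed
      obtain u where u: "u \<in> polyfun n" "u p \<noteq> 0"
        "\<And>z. relator q1 q2 l n i z = leading_relator q1 q2 l n p i z * u z"
        using relator_factorization[OF i] by metis
      obtain w where w: "w \<in> polyfun n" "vanishing n p N (\<lambda>z. u z * w z - 1)"
        using polyfun_inverse_mod[OF u(1,2), of N] by (elim bexE)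
      let ?M = "shifted_monomial n p \<gamma>"
      \<comment> \<open>\<open>pairing\<close> cancels the denominator of \<open>B\<close> exactly,
        and \<open>w\<close> cancels the unit \<open>u\<close> modulo order
        \<open>N\<close>.\<close>
      let ?f = "\<lambda>z. pairing n i z * (w z * ?M z)"
      have f: "?f \<in> polyfun n"
        by (intro polyfun_mult pairing_polyfun i w shifted_monomial_polyfun)
      have LM: "(\<lambda>z. leading_relator q1 q2 l n p i z * ?M z) \<in> regular n"
        by (intro regular.mult lead i mono)
      have Bf: "(\<lambda>z. B z * ?f z) \<in> regular n"
        by (intro regular.mult[OF B] polyfun_regular f)
      have "vanishing n p N (\<lambda>z. (u z * w z - 1) * (leading_relator q1 q2 l n p i z * ?M z))"
        by (rule vanishing_mult_regular[OF w(2) LM])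
      then have "vanishing n p N (\<lambda>z. B z * ?f z - leading_relator q1 q2 l n p i z * ?M z)"
      proof (rule vanishing.cong)
        fix z assume "z \<in> config n"
        then have "inverse (pairing n i z) * pairing n i z = 1"
          using pairing_nonzero[OF _ i] by simp
        moreover have "B z * ?f z = relator q1 q2 l n i z * (inverse (pairing n i z) * pairing n i z) * (w z * ?M z)"
          by (simp only: B_def mult_ac)
        ultimately show "(u z * w z - 1) * (leading_relator q1 q2 l n p i z * ?M z) =
            B z * ?f z - leading_relator q1 q2 l n p i z * ?M z"
          by (simp only: u(3)) (simp add: algebra_simps)
      qed
      from cong[OF this Bf LM]
      show "jet_functional n p c (\<lambda>z. leading_relator q1 q2 l n p i z * ?M z) = 0"
        using jet_functional_polyfun_zeroI[OF p B f zero] by simp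
    qed
  qed
qed

text \<open>Recurrences quantify over all functions on the naturals, whereas the coefficients of a
  relation live on indices that are 0 from \<open>n\<close> on. Truncation mediates between the two
  and commutes with \<open>inc i\<close> for \<open>i < n\<close>.\<close>

definition restrict_index :: "nat \<Rightarrow> (nat \<Rightarrow> nat) \<Rightarrow> nat \<Rightarrow> nat" where
  "restrict_index n \<gamma> i = (if i < n then \<gamma> i else 0)"

lemma restrict_index_inc: "i < n \<Longrightarrow> restrict_index n (inc i \<gamma>) = inc i (restrict_index n \<gamma>)"
  by (auto simp: restrict_index_def inc_def fun_eq_iff)

text \<open>For an admissible \<open>c\<close> this is the value of its functional at the centered
  monomial with exponent \<open>\<gamma>\<close>; the factorials come from differentiating that
  monomial.\<close>

definition taylor_value :: "nat \<Rightarrow> ((nat \<Rightarrow> nat) \<Rightarrow> complex) \<Rightarrow> (nat \<Rightarrow> nat) \<Rightarrow> complex" where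
  "taylor_value n c \<gamma> = c (restrict_index n \<gamma>) * (\<Prod>i<n. fact (\<gamma> i))"

lemma shifted_monomial_inc:
  "i < n \<Longrightarrow> shifted_monomial n p (inc i \<gamma>) z = (z i - p i) * shifted_monomial n p \<gamma> z"
  unfolding inc_def by (rule shifted_monomial_Suc)

context level_recurrence
begin

lemma recurrence_iff_leading:
  assumes p: "p \<in> config n" and c: "finite {\<alpha>. c \<alpha> \<noteq> 0}" "\<And>\<alpha> i. c \<alpha> \<noteq> 0 \<Longrightarrow> i \<ge> n \<Longrightarrow> \<alpha> i = 0"
    and i: "i < n"
    and Q: "\<And>z. Q z = (z i - p i - r i * (z (a i) - p (a i))) *
      (if i \<in> X then z i - p i - s i * (z (b i) - p (b i)) else 1)"
  shows "(\<forall>\<gamma>. jet_functional n p c (\<lambda>z. Q z * shifted_monomial n p \<gamma> z) = 0) \<longleftrightarrow>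
    recurrence i (taylor_value n c)"
proof -
  let ?m = "shifted_monomial n p"
  have D: "jet_functional n p c (?m \<gamma>) = taylor_value n c \<gamma>" for \<gamma>
    unfolding taylor_value_def restrict_index_def
    by (rule jet_functional_shifted_monomial[OF c(1)]) (rule c(2))
  have m: "?m \<gamma> \<in> regular n" for \<gamma> by (intro polyfun_regular shifted_monomial_polyfun)
  have am: "(\<lambda>z. t * ?m \<gamma> z) \<in> regular n" for \<gamma> t by (intro regular.mult regular.const m)
  have Da: "jet_functional n p c (\<lambda>z. t * ?m \<gamma> z) = t * taylor_value n c \<gamma>" for \<gamma> t
    by (simp add: jet_functional_scale[OF p m] D)
  show ?thesis
  proof (cases "i \<in> X")
    case True
    have "(\<lambda>z. Q z * ?m \<gamma> z) = (\<lambda>z. ?m (inc i (inc i \<gamma>)) z - r i * ?m (inc i (inc (a i) \<gamma>)) z -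
        s i * ?m (inc i (inc (b i) \<gamma>)) z + r i * s i * ?m (inc (a i) (inc (b i) \<gamma>)) z)" for \<gamma>
      using True i a_less[OF i] b_less[OF True] by (simp add: Q shifted_monomial_inc algebra_simps)
    then have "jet_functional n p c (\<lambda>z. Q z * ?m \<gamma> z) = taylor_value n c (inc i (inc i \<gamma>)) -
        r i * taylor_value n c (inc i (inc (a i) \<gamma>)) - s i * taylor_value n c (inc i (inc (b i) \<gamma>)) +
        r i * s i * taylor_value n c (inc (a i) (inc (b i) \<gamma>))" for \<gamma>
      by (simp add: jet_functional_add[OF p] jet_functional_diff[OF p] regular_diff m am D Da)
    then show ?thesis using True by (simp add: recurrence_def) (auto simp: algebra_simps)
  next
    case False
    have "(\<lambda>z. Q z * ?m \<gamma> z) = (\<lambda>z. ?m (inc i \<gamma>) z - r i * ?m (inc (a i) \<gamma>) z)" for \<gamma>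
      using False i a_less[OF i] by (simp add: Q shifted_monomial_inc algebra_simps)
    then have "jet_functional n p c (\<lambda>z. Q z * ?m \<gamma> z) =
        taylor_value n c (inc i \<gamma>) - r i * taylor_value n c (inc (a i) \<gamma>)" for \<gamma>
      by (simp add: jet_functional_diff[OF p] m am D Da)
    then show ?thesis using False by (simp add: recurrence_def)
  qed
qed

text \<open>The squarefree exponents supported in \<open>X\<close> serve as coordinates on the
  relations: existence of solutions gives surjectivity, uniqueness gives injectivity. Their
  factorials are 1, so \<open>c\<close> and \<open>taylor_value n c\<close> agree there.\<close>

lemma rank_solutions:
  assumes L: "L = {c. finite {\<alpha>. c \<alpha> \<noteq> 0} \<and> (\<forall>\<alpha>. c \<alpha> \<noteq> 0 \<longrightarrow> (\<forall>i\<ge>n. \<alpha> i = 0)) \<and>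
    solution (taylor_value n c)}"
  shows "(SUP B \<in> {B. B \<subseteq> L \<and> finite B \<and> cfun.independent B}. enat (card B)) = enat (2 ^ card X)"
proof -
  have finX: "finite X" using X_less by (rule finite_subset) simp
  let ?K = "set_index ` Pow X"
  have supp: "set_index T j = 0" if "T \<subseteq> X" "j \<ge> n" for T j
    using that X_less by (auto simp: set_index_def)
  have fact1: "(\<Prod>i<n. fact (set_index T i)) = (1 :: complex)" for T
    by (auto simp: set_index_def intro!: prod.neutral)
  have restr: "restrict_index n \<gamma> = \<gamma>" if "\<And>i. i \<ge> n \<Longrightarrow> \<gamma> i = 0" for \<gamma>
    using that by (auto simp: restrict_index_def fun_eq_iff)
  have "(SUP B \<in> {B. B \<subseteq> L \<and> finite B \<and> cfun.independent B}. enat (card B)) = enat (card ?K)"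
  proof (rule rank_eq_card)
    show "finite ?K" using finX by simp
  next
    fix c d assume cd: "c \<in> L" "d \<in> L"
    have "{\<alpha>. (c - d) \<alpha> \<noteq> 0} \<subseteq> {\<alpha>. c \<alpha> \<noteq> 0} \<union> {\<alpha>. d \<alpha> \<noteq> 0}" by auto
    then have "finite {\<alpha>. (c - d) \<alpha> \<noteq> 0}" by (rule finite_subset) (use cd in \<open>simp add: L\<close>)
    moreover have "taylor_value n (c - d) = (\<lambda>\<gamma>. taylor_value n c \<gamma> + (-1) * taylor_value n d \<gamma>)"
      by (simp add: taylor_value_def fun_eq_iff algebra_simps)
    moreover have "\<alpha> i = 0" if "(c - d) \<alpha> \<noteq> 0" "i \<ge> n" for \<alpha> i
    proof -
      have "c \<alpha> \<noteq> 0 \<or> d \<alpha> \<noteq> 0" using that(1) by auto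
      then show ?thesis using cd that(2) by (auto simp: L)
    qed
    moreover have "solution (\<lambda>\<gamma>. taylor_value n c \<gamma> + (-1) * taylor_value n d \<gamma>)"
      using cd recurrence_add[OF _ recurrence_scale] unfolding L solution_def by blast
    ultimately show "c - d \<in> L" unfolding L by simp
  next
    fix t c assume c: "c \<in> L"
    have "finite {\<alpha>. cscale t c \<alpha> \<noteq> 0}"
      by (rule finite_subset[of _ "{\<alpha>. c \<alpha> \<noteq> 0}"]) (use c in \<open>auto simp: L cscale_def\<close>)
    moreover have "taylor_value n (cscale t c) = (\<lambda>\<gamma>. t * taylor_value n c \<gamma>)"
      by (simp add: taylor_value_def cscale_def fun_eq_iff algebra_simps)
    moreover have "solution (\<lambda>\<gamma>. t * taylor_value n c \<gamma>)"
      using c recurrence_scale unfolding L solution_def by blast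
    ultimately show "cscale t c \<in> L" using c unfolding L by (simp add: cscale_def)
  next
    fix f :: "(nat \<Rightarrow> nat) \<Rightarrow> complex"
    obtain \<phi> where \<phi>: "solution \<phi>" "\<And>T. T \<subseteq> X \<Longrightarrow> \<phi> (set_index T) = f (set_index T)"
      using solution_exists[of "\<lambda>T. f (set_index T)"] by metis
    \<comment> \<open>Dividing by the factorials undoes \<open>taylor_value\<close>, and the cutoff
      enforces the support condition on relations.\<close>
    define c where "c \<gamma> = (if \<forall>i\<ge>n. \<gamma> i = 0 then \<phi> \<gamma> / (\<Prod>i<n. fact (\<gamma> i)) else 0)" for \<gamma>
    \<comment> \<open>The bound on the total degree confines the support to a finite box.\<close>
    have "{\<gamma>. c \<gamma> \<noteq> 0} \<subseteq> {\<gamma>. \<forall>i. (i \<in> {..<n} \<longrightarrow> \<gamma> i \<in> {..card X}) \<and> (i \<notin> {..<n} \<longrightarrow> \<gamma> i = 0)}"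
    proof
      fix \<gamma> assume "\<gamma> \<in> {\<gamma>. c \<gamma> \<noteq> 0}"
      then have \<gamma>: "\<forall>i\<ge>n. \<gamma> i = 0" "\<phi> \<gamma> \<noteq> 0" by (auto simp: c_def split: if_splits)
      then have "(\<Sum>i<n. \<gamma> i) \<le> card X"
        using solution_finite_support[OF \<phi>(1), of \<gamma>] by (auto simp: not_less[symmetric])
      moreover have "\<gamma> i \<le> (\<Sum>i<n. \<gamma> i)" if "i < n" for i
        using that by (intro member_le_sum) auto
      ultimately show "\<gamma> \<in> {\<gamma>. \<forall>i. (i \<in> {..<n} \<longrightarrow> \<gamma> i \<in> {..card X}) \<and> (i \<notin> {..<n} \<longrightarrow> \<gamma> i = 0)}"
        using \<gamma>(1) by (auto intro: order_trans)
    qed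
    then have fin: "finite {\<gamma>. c \<gamma> \<noteq> 0}"
      by (rule finite_subset) (rule finite_set_of_finite_funs; simp)
    have T: "taylor_value n c = (\<lambda>\<gamma>. \<phi> (restrict_index n \<gamma>))"
    proof
      fix \<gamma>
      have "(\<Prod>i<n. fact (restrict_index n \<gamma> i)) = (\<Prod>i<n. fact (\<gamma> i) :: complex)"
        by (rule prod.cong) (auto simp: restrict_index_def)
      moreover have "(\<Prod>i<n. fact (\<gamma> i) :: complex) \<noteq> 0" by simp
      ultimately show "taylor_value n c \<gamma> = \<phi> (restrict_index n \<gamma>)"
        by (simp add: taylor_value_def c_def) (simp add: restrict_index_def)
    qed
    have "recurrence i (\<lambda>\<gamma>. \<phi> (restrict_index n \<gamma>))" if "i < n" for i
    proof -
      have "recurrence i \<phi>" using \<phi>(1) that by (simp add: solution_def)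
      then show ?thesis
        using that a_less[OF that] b_less[of i] unfolding recurrence_def
        by (simp add: restrict_index_inc split: if_splits)
    qed
    then have "solution (taylor_value n c)" by (simp add: T solution_def)
    then have "c \<in> L" using fin by (auto simp: L c_def)
    moreover have "c (set_index T) = f (set_index T)" if "T \<subseteq> X" for T
      using \<phi>(2)[OF that] supp[OF that] by (simp add: c_def fact1)
    ultimately show "\<exists>c\<in>L. \<forall>x\<in>?K. c x = f x" by (intro bexI[of _ c]) auto
  next
    fix c assume c: "c \<in> L" and zero: "\<And>x. x \<in> ?K \<Longrightarrow> c x = 0"
    have "c \<gamma> = 0" for \<gamma>
    proof (rule ccontr)
      assume nz: "c \<gamma> \<noteq> 0"
      then have \<gamma>: "\<And>i. i \<ge> n \<Longrightarrow> \<gamma> i = 0" using c by (simp add: L)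
      have sol: "solution (taylor_value n c)" using c by (simp add: L)
      have "taylor_value n c \<gamma> = 0"
      proof (rule solution_unique[OF sol \<gamma>])
        fix T assume "T \<subseteq> X"
        then show "taylor_value n c (set_index T) = 0"
          using zero[of "set_index T"] restr[OF supp] by (simp add: taylor_value_def)
      qed
      then show False using nz by (simp add: taylor_value_def restr[OF \<gamma>])
    qed
    then show "c = 0" by (simp add: fun_eq_iff)
  qed
  moreover have "card ?K = 2 ^ card X"
    using finX by (subst card_image) (auto simp: inj_on_def set_index_inj card_Pow)
  ultimately show ?thesis by simp
qed

end

lemma linear_relations_eq:
  assumes "p \<in> config n"
  shows "linear_relations n (ideal_component q1 q2 l n) p =
    {c. finite {\<alpha>. c \<alpha> \<noteq> 0} \<and> (\<forall>\<alpha>. c \<alpha> \<noteq> 0 \<longrightarrow> (\<forall>i\<ge>n. \<alpha> i = 0)) \<and>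
     (\<forall>i<n. \<forall>\<gamma>. jet_functional n p c (\<lambda>z. leading_relator q1 q2 l n p i z * shifted_monomial n p \<gamma> z) = 0)}"
  unfolding linear_relations_def jet_functional_def[symmetric]
  using relation_iff_leading[OF assms] by blast

theorem theorem3p1:
  fixes q1 q2 l :: complex and Y X :: "(nat \<times> nat) set" and n k :: nat
    and v :: "nat \<Rightarrow> nat \<times> nat"
  assumes "generic q1 q2"
    and "l \<noteq> 0"
    and "finite Y" and "card Y = n"
    and "(0, 0) \<in> Y"
    and "X = double_parent_vertices Y" and "k = card X"
    and "bij_betw v {..<n} Y"
  shows "(card (trees_on Y) = 0 \<or> card (trees_on Y) = 2 ^ k) \<and>
    zero_multiplicity n (ideal_component q1 q2 l n) (\<lambda>i. vertex_coord q1 q2 l (v i)) =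
      (if card (trees_on Y) = 0 then 0 else 2 ^ k)"
proof -
  define p where "p i = vertex_coord q1 q2 l (v i)" for i
  define idx where "idx w = inv_into {..<n} v w" for w
  let ?L = "linear_relations n (ideal_component q1 q2 l n) p"
  have q: "q1 \<noteq> 0" "q2 \<noteq> 0" using assms(1) by (auto simp: generic_def)
  have vY: "v i \<in> Y" if "i < n" for i using bij_betwE[OF assms(8)] that by simp
  have idx: "idx w < n" "v (idx w) = w" if "w \<in> Y" for w
    using that bij_betw_inv_into_right[OF assms(8)] bij_betw_inv_into[OF assms(8)]
    by (auto simp: idx_def bij_betw_def)
  have v_eq: "v j = w \<longleftrightarrow> w \<in> Y \<and> j = idx w" if "j < n" for j w
    using idx[of w] vY[OF that] that bij_betw_inv_into_left[OF assms(8), of j] by (auto simp: idx_def)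
  have p_eq: "p i = p j \<longleftrightarrow> v i = v j" for i j
    by (simp add: p_def vertex_coord_eq_iff[OF assms(1,2)])
  have p: "p \<in> config n"
    using assms(2) q bij_betw_imp_inj_on[OF assms(8)]
    by (auto simp: config_def inj_on_def p_eq) (auto simp: p_def vertex_coord_def)
  have root: "p i = l \<longleftrightarrow> v i = (0, 0)" for i
    using vertex_coord_eq_iff[OF assms(1,2), of "v i" "(0, 0)"] by (simp add: p_def vertex_coord_def)
  \<comment> \<open>Multiplication by \<open>q1\<close> is a step in the grid, so genericity turns
    this equation of coordinates into one of vertices: the factor \<open>z i - q1 * z j\<close>
    vanishes at the point exactly for the parent in the first direction.\<close>
  have left: "p i = q1 * p j \<longleftrightarrow> fst (v i) > 0 \<and> v j = (fst (v i) - 1, snd (v i))" for i j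
  proof -
    have "q1 * p j = vertex_coord q1 q2 l (Suc (fst (v j)), snd (v j))"
      by (simp add: p_def vertex_coord_def)
    then have "p i = q1 * p j \<longleftrightarrow> v i = (Suc (fst (v j)), snd (v j))"
      by (simp add: p_def vertex_coord_eq_iff[OF assms(1,2)])
    then show ?thesis by (cases "v i"; cases "v j") auto
  qed
  have right: "p i = q2 * p j \<longleftrightarrow> snd (v i) > 0 \<and> v j = (fst (v i), snd (v i) - 1)" for i j
  proof -
    have "q2 * p j = vertex_coord q1 q2 l (fst (v j), Suc (snd (v j)))"
      by (simp add: p_def vertex_coord_def)
    then have "p i = q2 * p j \<longleftrightarrow> v i = (fst (v j), Suc (snd (v j)))"
      by (simp add: p_def vertex_coord_eq_iff[OF assms(1,2)])
    then show ?thesis by (cases "v i"; cases "v j") auto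
  qed
  let ?lp = "\<lambda>i. left_parent Y (v i)" and ?rp = "\<lambda>i. right_parent Y (v i)"
  let ?li = "\<lambda>i. idx (fst (v i) - 1, snd (v i))" and ?ri = "\<lambda>i. idx (fst (v i), snd (v i) - 1)"
  have li: "?li i < n" "v (?li i) = (fst (v i) - 1, snd (v i))" "p i = q1 * p (?li i)" if "?lp i" for i
    using that idx by (auto simp: left_parent_def left)
  have ri: "?ri i < n" "v (?ri i) = (fst (v i), snd (v i) - 1)" "p i = q2 * p (?ri i)" if "?rp i" for i
    using that idx by (auto simp: right_parent_def right)
  have left_set: "{j. j < n \<and> j \<noteq> i \<and> p i = q1 * p j} = (if ?lp i then {?li i} else {})" for i
  proof -
    have "j < n \<and> j \<noteq> i \<and> p i = q1 * p j \<longleftrightarrow> ?lp i \<and> j = ?li i" for j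
    proof
      assume "j < n \<and> j \<noteq> i \<and> p i = q1 * p j"
      then show "?lp i \<and> j = ?li i" by (auto simp: left v_eq left_parent_def)
    next
      assume j: "?lp i \<and> j = ?li i"
      then have "j < n" "p i = q1 * p j" "v j \<noteq> v i"
        using li[of i] by (auto simp: left_parent_def prod_eq_iff)
      then show "j < n \<and> j \<noteq> i \<and> p i = q1 * p j" by auto
    qed
    then show ?thesis by auto
  qed
  have right_set: "{j. j < n \<and> j \<noteq> i \<and> p i = q2 * p j} = (if ?rp i then {?ri i} else {})" for i
  proof -
    have "j < n \<and> j \<noteq> i \<and> p i = q2 * p j \<longleftrightarrow> ?rp i \<and> j = ?ri i" for j
    proof
      assume "j < n \<and> j \<noteq> i \<and> p i = q2 * p j"
      then show "?rp i \<and> j = ?ri i" by (auto simp: right v_eq right_parent_def)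
    next
      assume j: "?rp i \<and> j = ?ri i"
      then have "j < n" "p i = q2 * p j" "v j \<noteq> v i"
        using ri[of i] by (auto simp: right_parent_def prod_eq_iff)
      then show "j < n \<and> j \<noteq> i \<and> p i = q2 * p j" by auto
    qed
    then show ?thesis by auto
  qed
  have lead: "leading_relator q1 q2 l n p i z = (if v i = (0, 0) then z i - l else 1) *
      ((if ?lp i then z i - q1 * z (?li i) else 1) * (if ?rp i then z i - q2 * z (?ri i) else 1))" for i z
    by (simp add: leading_relator_def left_set right_set root)
  have no_parents: "\<not> ?lp i \<and> \<not> ?rp i" if "v i = (0, 0)" for i
    using that by (simp add: left_parent_def right_parent_def)
  have trees: "card (trees_on Y) = (if \<forall>v\<in>Y - {(0, 0)}. left_parent Y v \<or> right_parent Y v then 2 ^ k else 0)"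
    using card_trees_on_eq[OF assms(3,5)] assms(6,7) by simp
  have "zero_multiplicity n (ideal_component q1 q2 l n) p = (if card (trees_on Y) = 0 then 0 else 2 ^ k)"
  proof (cases "\<forall>v\<in>Y - {(0, 0)}. left_parent Y v \<or> right_parent Y v")
    case True
    define X' where "X' = {i. i < n \<and> v i \<in> X}"
    \<comment> \<open>A single parent takes the slot \<open>a\<close>, whichever of the two it is,
      with its ratio in \<open>r\<close>; the slot \<open>b\<close> serves vertices with two
      parents. The root points to itself, with ratio 0.\<close>
    define a where "a i = (if ?lp i then ?li i else if ?rp i then ?ri i else i)" for i
    define b where "b = ?ri"
    define r where "r i = (if ?lp i then q1 else if ?rp i then q2 else 0)" for i
    define s where "s = (\<lambda>i :: nat. q2)"
    define lev where "lev i = fst (v i) + snd (v i)" for i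
    have X': "i \<in> X' \<longleftrightarrow> i < n \<and> ?lp i \<and> ?rp i" for i
      using vY[of i] by (auto simp: X'_def assms(6) double_parent_vertices_eq)
    have lev_li: "lev (?li i) < lev i" if "?lp i" for i
      using li(2)[OF that] that by (auto simp: lev_def left_parent_def)
    have lev_ri: "lev (?ri i) < lev i" if "?rp i" for i
      using ri(2)[OF that] that by (auto simp: lev_def right_parent_def)
    interpret level_recurrence n X' a b r s lev
    proof
      show "X' \<subseteq> {..<n}" by (auto simp: X'_def)
      show "a i < n" if "i < n" for i using that li(1) ri(1) by (auto simp: a_def)
      show "b i < n" if "i \<in> X'" for i using that ri(1) by (simp add: X' b_def)
      show "lev (a i) < lev i" if "i < n" "i \<in> X' \<or> r i \<noteq> 0" for i
        using that lev_li[of i] lev_ri[of i] by (auto simp: a_def r_def X' split: if_splits)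
      show "lev (b i) < lev i" if "i \<in> X'" for i using that lev_ri[of i] by (simp add: b_def X')
    qed
    have Q: "leading_relator q1 q2 l n p i z = (z i - p i - r i * (z (a i) - p (a i))) *
        (if i \<in> X' then z i - p i - s i * (z (b i) - p (b i)) else 1)" if i: "i < n" for i z
    proof (cases "v i = (0, 0)")
      \<comment> \<open>At the root \<open>p i = l\<close> and \<open>r i = 0\<close>, so both sides
        are \<open>z i - p i\<close>.\<close>
      case True
      then show ?thesis
        using no_parents[OF True] root[of i] by (simp add: lead X' r_def)
    next
      case False
      then have par: "?lp i \<or> ?rp i" using True vY[OF i] by auto
      \<comment> \<open>The constants cancel because the coordinate of a vertex is \<open>q1\<close>
        times that of this parent; the factor becomes linear in the centered coordinates.\<close>
      have L: "(if ?lp i then z i - q1 * z (?li i) else 1) =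
          (if ?lp i then z i - p i - q1 * (z (?li i) - p (?li i)) else 1)"
        using li(3)[of i] by (auto simp: algebra_simps)
      have R: "(if ?rp i then z i - q2 * z (?ri i) else 1) =
          (if ?rp i then z i - p i - q2 * (z (?ri i) - p (?ri i)) else 1)"
        using ri(3)[of i] by (auto simp: algebra_simps)
      show ?thesis
        unfolding lead L R using par False i
        by (cases "?lp i"; cases "?rp i") (simp_all add: X' a_def b_def r_def s_def)
    qed
    have "?L = {c. finite {\<alpha>. c \<alpha> \<noteq> 0} \<and> (\<forall>\<alpha>. c \<alpha> \<noteq> 0 \<longrightarrow> (\<forall>i\<ge>n. \<alpha> i = 0)) \<and>
        solution (taylor_value n c)}"
      unfolding linear_relations_eq[OF p] solution_def
    proof (intro Collect_cong conj_cong refl)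
      fix c :: "(nat \<Rightarrow> nat) \<Rightarrow> complex"
      assume c: "finite {\<alpha>. c \<alpha> \<noteq> 0}" "\<forall>\<alpha>. c \<alpha> \<noteq> 0 \<longrightarrow> (\<forall>i\<ge>n. \<alpha> i = 0)"
      have "(\<forall>\<gamma>. jet_functional n p c (\<lambda>z. leading_relator q1 q2 l n p i z * shifted_monomial n p \<gamma> z) = 0) \<longleftrightarrow>
          recurrence i (taylor_value n c)" if "i < n" for i
        by (rule recurrence_iff_leading[OF p c(1) _ that Q[OF that]]) (use c(2) in blast)
      then show "(\<forall>i<n. \<forall>\<gamma>. jet_functional n p c (\<lambda>z. leading_relator q1 q2 l n p i z * shifted_monomial n p \<gamma> z) = 0) \<longleftrightarrow>
          (\<forall>i<n. recurrence i (taylor_value n c))" by blast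
    qed
    from rank_solutions[OF this] have rank: "zero_multiplicity n (ideal_component q1 q2 l n) p = enat (2 ^ card X')"
      by (simp add: zero_multiplicity_def)
    have "bij_betw v X' X"
    proof (rule bij_betw_subset[OF assms(8)])
      show "X' \<subseteq> {..<n}" by (auto simp: X'_def)
      show "v ` X' = X"
      proof (intro equalityI subsetI)
        fix w assume w: "w \<in> X"
        then have "w \<in> Y" by (simp add: assms(6) double_parent_vertices_eq)
        then show "w \<in> v ` X'" using w idx[of w] by (intro image_eqI[of _ _ "idx w"]) (auto simp: X'_def)
      qed (auto simp: X'_def)
    qed
    then have "card X' = k" using bij_betw_same_card assms(7) by metis
    with rank show ?thesis using True trees by (simp flip: of_nat_eq_enat)
  next
    case False
    then obtain w where w: "w \<in> Y" "w \<noteq> (0, 0)" "\<not> left_parent Y w" "\<not> right_parent Y w" by blast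
    have "c = 0" if c: "c \<in> ?L" for c
    proof
      fix \<gamma>
      have cc: "finite {\<alpha>. c \<alpha> \<noteq> 0}" "\<forall>\<alpha>. c \<alpha> \<noteq> 0 \<longrightarrow> (\<forall>i\<ge>n. \<alpha> i = 0)"
        "\<forall>i<n. \<forall>\<gamma>. jet_functional n p c (\<lambda>z. leading_relator q1 q2 l n p i z * shifted_monomial n p \<gamma> z) = 0"
        using c unfolding linear_relations_eq[OF p] by blast+
      \<comment> \<open>No factor of the relator of \<open>w\<close> vanishes at the point, so its
        leading relator is 1 and a relation kills every monomial.\<close>
      have "jet_functional n p c (shifted_monomial n p \<gamma>) = 0"
        using cc(3)[rule_format, OF idx(1)[OF w(1)], of \<gamma>] w by (simp add: lead idx(2))
      then have "c (\<lambda>i. if i < n then \<gamma> i else 0) * (\<Prod>i<n. fact (\<gamma> i)) = 0"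
        using jet_functional_shifted_monomial[OF cc(1), of n p \<gamma>] cc(2) by simp
      then have z: "c (\<lambda>i. if i < n then \<gamma> i else 0) = 0" by simp
      show "c \<gamma> = 0 \<gamma>"
      proof (rule ccontr)
        assume "c \<gamma> \<noteq> 0 \<gamma>"
        then have "c \<gamma> \<noteq> 0" by simp
        then have "(\<lambda>i. if i < n then \<gamma> i else 0) = \<gamma>" using cc(2) by (auto simp: fun_eq_iff)
        then show False using z \<open>c \<gamma> \<noteq> 0\<close> by simp
      qed
    qed
    \<comment> \<open>The zero space has only the empty independent subset, which makes the supremum
      0.\<close>
    then have "{B. B \<subseteq> ?L \<and> finite B \<and> cfun.independent B} = {{}}"
      using cfun.dependent_zero by (auto simp: cfun.independent_empty)
    then have "zero_multiplicity n (ideal_component q1 q2 l n) p = 0"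
      by (simp add: zero_multiplicity_def zero_enat_def)
    moreover have "card (trees_on Y) = 0" unfolding trees using False by (rule if_not_P)
    ultimately show ?thesis by simp
  qed
  then show ?thesis
    using trees unfolding p_def by simp
qed

end
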